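(* Let $T>0$, $n\geq3$, and let $u$ be a fixed deterministic drift. As $\sigma\to\infty$, the relative gain $G(u,\sigma,T,n)$ of the superefficient estimator over $\hat u=X$ converges to $$(n-2)^2\,\frac{8}{\pi^2}\,\mathbb{E}\left[\left(\sum_{l=1}^n(2l-1)^2\eta_l^2\right)^{-1}\right],$$ where $\eta_1,\dots,\eta_n$ are independent standard Gaussian random variables.
   Context: Let $\sigma,T>0$ be constants and let $(X_t)_{t\in[0,T]}$ be, under $\mathbb{P}$, a Brownian motion with variance $\sigma^2$ (covariance $\sigma^2(s\wedge t)$). $H$ is the space of absolutely continuous functions $v$ on $[0,T]$ with $v(0)=0$, $\dot v\in L^2([0,T],dt)$, with $\langle v_1,v_2\rangle_H=\sigma^2\int_0^T\dot v_1\dot v_2\,ds$, and $\langle v_1,v_2\rangle=\int_0^T\dot v_1\dot v_2\,ds$; $X(h)=\int_0^T\dot h(s)dX_s$ and $(\Gamma h)(t)=\sigma^2h(t)$. For deterministic $u\in H$, $\mathbb{P}_u$ (expectation $\mathbb{E}_u$) is the law under which $X-u$ is a Brownian motion with variance $\sigma^2$. Let $$h_k(t)=\frac{\sqrt{2T}}{\sigma\pi(k-1/2)}\sin\left(\left(k-\tfrac12\right)\frac{\pi t}{T}\right),\qquad\lambda_k=\frac{\sigma T}{\pi(k-1/2)},\qquad k\geq1,$$ which is an orthonormal basis of $H$ with $(\Gamma h_k)$ orthogonal in $L^2([0,T],dt)$ and $\lambda_k=\|\Gamma h_k\|_{L^2([0,T],dt)}$. For $n\geq3$ let $F=\left(\sum_{k=1}^n\lambda_k^{-2}X(h_k)^2\right)^{(2-n)/2}$,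 and let $X+D\log F$ be the corresponding Stein-type estimator of $u$, where $D_t\log F=-(n-2)\,\dfrac{\sum_{k=1}^n\lambda_k^{-2}X(h_k)\Gamma h_k(t)}{\sum_{l=1}^n\lambda_l^{-2}X(h_l)^2}$. With $\Delta G=\int_0^TD_tD_tG\,dt$ and $\mathrm{R}=\mathbb{E}_u\left[\int_0^T|X_t-u_t|^2dt\right]=\sigma^2T^2/2$, the gain is $$G(u,\sigma,T,n):=-\frac{4}{\mathrm{R}}\,\mathbb{E}_u\left[\frac{\Delta\sqrt F}{\sqrt F}\right]=2(n-2)^2\,\mathbb{E}\left[\left(\sum_{l=1}^n\left(\pi\left(l-\tfrac12\right)\big(\eta_l+\langle u,h_l\rangle\big)\right)^2\right)^{-1}\right],$$ with $(\eta_l)_{l\ge1}$ independent standard Gaussian random variables (note that $h_l$ depends on $\sigma$). *)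

theory Defs
  imports "HOL-Probability.Probability"
begin

subsection \<open>The space H\<close>

definition absolutely_continuous_on :: "real \<Rightarrow> real \<Rightarrow> (real \<Rightarrow> real) \<Rightarrow> bool" where
  "absolutely_continuous_on l r v \<longleftrightarrow>
    (\<forall>\<epsilon>>0. \<exists>\<delta>>0. \<forall>N (a :: nat \<Rightarrow> real) b.
       (\<forall>i<N. l \<le> a i \<and> a i \<le> b i \<and> b i \<le> r) \<and>
       (\<forall>i<N. \<forall>j<N. i \<noteq> j \<longrightarrow> {a i<..<b i} \<inter> {a j<..<b j} = {}) \<and>
       (\<Sum>i<N. b i - a i) < \<delta>
       \<longrightarrow> (\<Sum>i<N. \<bar>v (b i) - v (a i)\<bar>) < \<epsilon>)"

text \<open>
  As a set, H does not depend on \<open>\<sigma>\<close>. Almost everywhere differentiability is implied by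
  absolute continuity (Lebesgue) and is listed only because it makes \<open>deriv v\<close> meaningful;
  the values of \<open>deriv v\<close> on the exceptional null set are irrelevant.
\<close>

definition H_space :: "real \<Rightarrow> (real \<Rightarrow> real) set" where
  "H_space T = {v. absolutely_continuous_on 0 T v \<and> v 0 = 0 \<and>
     (AE s in lebesgue. s \<in> {0<..<T} \<longrightarrow> v differentiable (at s)) \<and>
     set_borel_measurable lebesgue {0..T} (deriv v) \<and>
     set_integrable lebesgue {0..T} (\<lambda>s. (deriv v s)\<^sup>2)}"

subsection \<open>Brownian motion with variance \<open>\<sigma>\<^sup>2\<close>, and its drifted law\<close>

text \<open>Degenerate (almost surely constant) variables count as Gaussian.\<close>

definition gaussian_rv :: "'a measure \<Rightarrow> ('a \<Rightarrow> real) \<Rightarrow> bool" where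
  "gaussian_rv M Y \<longleftrightarrow> Y \<in> borel_measurable M \<and>
     ((\<exists>m s. 0 < s \<and> distributed M lborel Y (normal_density m s)) \<or>
      (\<exists>m. AE \<omega> in M. Y \<omega> = m))"

definition centered_gaussian_process ::
    "'a measure \<Rightarrow> real set \<Rightarrow> (real \<Rightarrow> 'a \<Rightarrow> real) \<Rightarrow> bool" where
  "centered_gaussian_process M I W \<longleftrightarrow>
     (\<forall>J c. finite J \<and> J \<subseteq> I \<longrightarrow> gaussian_rv M (\<lambda>\<omega>. \<Sum>t\<in>J. c t * W t \<omega>)) \<and>
     (\<forall>t\<in>I. (LINT \<omega>|M. W t \<omega>) = 0)"

definition brownian_motion ::
    "'a measure \<Rightarrow> real \<Rightarrow> real \<Rightarrow> (real \<Rightarrow> 'a \<Rightarrow> real) \<Rightarrow> bool" where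
  "brownian_motion M T \<sigma> W \<longleftrightarrow> prob_space M \<and>
     centered_gaussian_process M {0..T} W \<and>
     (\<forall>s\<in>{0..T}. \<forall>t\<in>{0..T}. (LINT \<omega>|M. W s \<omega> * W t \<omega>) = \<sigma>\<^sup>2 * min s t) \<and>
     (\<forall>\<omega>\<in>space M. continuous_on {0..T} (\<lambda>t. W t \<omega>))"

text \<open>The measure \<open>M\<close> plays the role of \<open>\<P>\<^sub>u\<close>.\<close>

definition drifted_brownian_motion ::
    "'a measure \<Rightarrow> real \<Rightarrow> real \<Rightarrow> (real \<Rightarrow> real) \<Rightarrow> (real \<Rightarrow> 'a \<Rightarrow> real) \<Rightarrow> bool" where
  "drifted_brownian_motion M T \<sigma> u X \<longleftrightarrow> brownian_motion M T \<sigma> (\<lambda>t \<omega>. X t \<omega> - u t)"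

subsection \<open>The stochastic integral of a deterministic function\<close>

definition step_fun :: "nat \<Rightarrow> (nat \<Rightarrow> real) \<Rightarrow> (nat \<Rightarrow> real) \<Rightarrow> real \<Rightarrow> real" where
  "step_fun N c \<tau> s = (\<Sum>i<N. c i * indicator {\<tau> i<..\<tau> (Suc i)} s)"

definition step_integral ::
    "(real \<Rightarrow> 'a \<Rightarrow> real) \<Rightarrow> nat \<Rightarrow> (nat \<Rightarrow> real) \<Rightarrow> (nat \<Rightarrow> real) \<Rightarrow> 'a \<Rightarrow> real" where
  "step_integral X N c \<tau> \<omega> = (\<Sum>i<N. c i * (X (\<tau> (Suc i)) \<omega> - X (\<tau> i) \<omega>))"

text \<open>
  \<open>Y\<close> is a version of \<open>\<integral>\<^sub>0\<^sup>T f dX\<close>: the mean square limit of the integrals of step functions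
  that converge to \<open>f\<close> in \<open>L\<^sup>2([0,T])\<close>. Such a \<open>Y\<close> is determined up to null sets only.
\<close>

definition is_stochastic_integral ::
    "'a measure \<Rightarrow> real \<Rightarrow> (real \<Rightarrow> 'a \<Rightarrow> real) \<Rightarrow> (real \<Rightarrow> real) \<Rightarrow> ('a \<Rightarrow> real) \<Rightarrow> bool" where
  "is_stochastic_integral M T X f Y \<longleftrightarrow> Y \<in> borel_measurable M \<and>
     (\<exists>N c \<tau>.
        (\<forall>m. 0 \<le> \<tau> m 0 \<and> (\<forall>i<N m. \<tau> m i \<le> \<tau> m (Suc i)) \<and> \<tau> m (N m) \<le> T) \<and>
        (\<lambda>m. \<integral>\<^sup>+ s\<in>{0..T}. ennreal ((step_fun (N m) (c m) (\<tau> m) s - f s)\<^sup>2) \<partial>lebesgue)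
          \<longlonglongrightarrow> 0 \<and>
        (\<lambda>m. \<integral>\<^sup>+ \<omega>. ennreal ((step_integral X (N m) (c m) (\<tau> m) \<omega> - Y \<omega>)\<^sup>2) \<partial>M)
          \<longlonglongrightarrow> 0)"

text \<open>\<open>Y\<close> is a version of \<open>X(h)\<close>.\<close>

definition is_X_of ::
    "'a measure \<Rightarrow> real \<Rightarrow> (real \<Rightarrow> 'a \<Rightarrow> real) \<Rightarrow> (real \<Rightarrow> real) \<Rightarrow> ('a \<Rightarrow> real) \<Rightarrow> bool" where
  "is_X_of M T X h Y \<longleftrightarrow> is_stochastic_integral M T X (deriv h) Y"

subsection \<open>Malliavin derivative and Laplacian of cylindrical functionals\<close>

text \<open>
  A cylindrical functional \<open>g(X(h\<^sub>1),\<dots>,X(h\<^sub>n))\<close> is represented by \<open>g\<close>, a function of the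
  coordinates \<open>x 1, \<dots>, x n\<close>. Then \<open>D\<^sub>t g(X(h\<^sub>1),\<dots>,X(h\<^sub>n))\<close> is represented by
  \<open>malliavin_D \<sigma> n h t g\<close>, again a function of the coordinates, so that \<open>D\<^sub>t D\<^sub>t\<close> is the iterate.
\<close>

definition Gam :: "real \<Rightarrow> (real \<Rightarrow> real) \<Rightarrow> real \<Rightarrow> real" where
  "Gam \<sigma> h t = \<sigma>\<^sup>2 * h t"

definition partial_deriv :: "nat \<Rightarrow> ((nat \<Rightarrow> real) \<Rightarrow> real) \<Rightarrow> (nat \<Rightarrow> real) \<Rightarrow> real" where
  "partial_deriv i g x = deriv (\<lambda>r. g (x(i := r))) (x i)"

definition malliavin_D ::
    "real \<Rightarrow> nat \<Rightarrow> (nat \<Rightarrow> real \<Rightarrow> real) \<Rightarrow> real \<Rightarrow>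
     ((nat \<Rightarrow> real) \<Rightarrow> real) \<Rightarrow> (nat \<Rightarrow> real) \<Rightarrow> real" where
  "malliavin_D \<sigma> n h t g x = (\<Sum>i=1..n. partial_deriv i g x * Gam \<sigma> (h i) t)"

definition malliavin_laplacian ::
    "real \<Rightarrow> real \<Rightarrow> nat \<Rightarrow> (nat \<Rightarrow> real \<Rightarrow> real) \<Rightarrow>
     ((nat \<Rightarrow> real) \<Rightarrow> real) \<Rightarrow> (nat \<Rightarrow> real) \<Rightarrow> real" where
  "malliavin_laplacian T \<sigma> n h g x =
     (LINT t:{0..T}|lebesgue. malliavin_D \<sigma> n h t (malliavin_D \<sigma> n h t g) x)"

subsection \<open>The Stein-type functional and the gain\<close>

definition h_basis :: "real \<Rightarrow> real \<Rightarrow> nat \<Rightarrow> real \<Rightarrow> real" where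
  "h_basis \<sigma> T k t =
     sqrt (2 * T) / (\<sigma> * pi * (real k - 1 / 2)) * sin ((real k - 1 / 2) * (pi * t / T))"

definition lam :: "real \<Rightarrow> real \<Rightarrow> nat \<Rightarrow> real" where
  "lam \<sigma> T k = \<sigma> * T / (pi * (real k - 1 / 2))"

definition F_stein :: "real \<Rightarrow> real \<Rightarrow> nat \<Rightarrow> (nat \<Rightarrow> real) \<Rightarrow> real" where
  "F_stein \<sigma> T n x = (\<Sum>k=1..n. (x k)\<^sup>2 / (lam \<sigma> T k)\<^sup>2) powr ((2 - real n) / 2)"

text \<open>The risk of the estimator \<open>X\<close> of \<open>u\<close>.\<close>

definition risk :: "'a measure \<Rightarrow> real \<Rightarrow> (real \<Rightarrow> 'a \<Rightarrow> real) \<Rightarrow> (real \<Rightarrow> real) \<Rightarrow> real" where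
  "risk M T X u = (LINT \<omega>|M. (LINT t:{0..T}|lebesgue. \<bar>X t \<omega> - u t\<bar>\<^sup>2))"

text \<open>In \<open>gain\<close>, the argument \<open>Y k\<close> stands for \<open>X(h\<^sub>k)\<close>.\<close>

definition gain ::
    "'a measure \<Rightarrow> (real \<Rightarrow> 'a \<Rightarrow> real) \<Rightarrow> (nat \<Rightarrow> 'a \<Rightarrow> real) \<Rightarrow>
     (real \<Rightarrow> real) \<Rightarrow> real \<Rightarrow> real \<Rightarrow> nat \<Rightarrow> real" where
  "gain M X Y u \<sigma> T n =
     - (4 / risk M T X u) *
       (LINT \<omega>|M. malliavin_laplacian T \<sigma> n (h_basis \<sigma> T) (\<lambda>x. sqrt (F_stein \<sigma> T n x)) (\<lambda>k. Y k \<omega>)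
                    / sqrt (F_stein \<sigma> T n (\<lambda>k. Y k \<omega>)))"

end

theory Submission
  imports Defs
begin

text \<open>
  Write \<open>q(x) = (\<Sum>k=1..n. (2k-1)\<^sup>2 x\<^sub>k\<^sup>2)\<close>. The Gaussian Laplacian of
  \<open>sqrt F\<close> only sees the diagonal second derivatives, because the functions \<open>\<Gamma>h\<^sub>k\<close>
  are orthogonal, and since \<open>sqrt F\<close> is a power of a quadratic form the quotient
  \<open>\<Delta> sqrt F / sqrt F\<close> is a constant multiple of \<open>1 / q\<close>
  (\<open>malliavin_laplacian_sqrt_F_stein\<close>). Dividing by the risk \<open>\<sigma>\<^sup>2 T\<^sup>2 / 2\<close>
  turns the gain into \<open>8 (n-2)\<^sup>2 / \<pi>\<^sup>2\<close> times the expectation of \<open>1 / q(Y)\<close>,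
  where \<open>Y\<^sub>k = X(h\<^sub>k)\<close> (\<open>gain_eq_expectation_inverse\<close>). The \<open>Y\<^sub>k\<close> are jointly
  Gaussian with identity covariance, whatever \<open>\<sigma>\<close> is; only their means
  \<open>\<mu>\<^sub>k = \<langle>u, h\<^sub>k\<rangle>\<close> depend on \<open>\<sigma>\<close>, and they vanish as \<open>\<sigma> \<rightarrow> \<infinity>\<close> because
  \<open>\<parallel>h\<^sub>k'\<parallel> = 1 / \<sigma>\<close> in \<open>L\<^sup>2\<close> (\<open>stochastic_integrals_gaussian\<close>). So the
  statement is that the inverse moment of \<open>q\<close> is continuous in the mean, at mean zero.

  The law of the vector \<open>Y\<close> enters through its characteristic function alone. On the one hand
  \<open>1 / q\<close> is the integral of \<open>exp (- s q)\<close> over \<open>s \<ge> 0\<close>. On the other hand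
  \<open>exp (- s q(y))\<close> is itself a characteristic function, that of independent standard Gaussian
  variables \<open>\<eta>\<^sub>k\<close>, so that Fubini's theorem gives
  \<open>E exp (- s q(Y)) = E (exp (i sqrt (2 s) (\<Sum>k. (2k-1) \<eta>\<^sub>k \<mu>\<^sub>k)) exp (- s q(\<eta>)))\<close>
  (\<open>expectation_exp_quadratic_form\<close>). The right-hand side is dominated by its value at
  \<open>\<mu> = 0\<close>, which is at most \<open>(1 + 2 s) powr (- 3 / 2)\<close> for \<open>n \<ge> 3\<close> and therefore integrable
  in \<open>s\<close>. Dominated convergence, first in \<open>\<eta>\<close> and then in \<open>s\<close>, yields the limit.

  That the means exist and are small rests on
  \<open>u(b) - u(a) = \<integral>\<^sub>a\<^sup>b u'\<close> for absolutely continuous \<open>u\<close>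
  (\<open>integral_deriv_of_absolutely_continuous\<close>) and the Cauchy-Schwarz inequality.
\<close>

section \<open>Absolutely continuous functions and their derivatives\<close>

text \<open>
  The gauge integral gives a direct proof. At a point of differentiability the gauge is the one
  from the definition of the derivative, as in the classical fundamental theorem. At a point of the
  exceptional null set the gauge keeps the tagged intervals inside an open set of small measure,
  and there absolute continuity makes the sum of the increments small.
\<close>

lemma integral_deriv_of_absolutely_continuous:
  fixes v :: "real \<Rightarrow> real"
  assumes ac: "absolutely_continuous_on l r v"
    and diff: "AE s in lebesgue. s \<in> {l<..<r} \<longrightarrow> v differentiable (at s)"
    and ab: "l \<le> a" "a \<le> b" "b \<le> r"
  shows "(deriv v has_integral v b - v a) {a..b}"
proof -
  define D where "D = {s \<in> {l<..<r}. v differentiable (at s)}"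
  define f where "f s = (if s \<in> D then deriv v s else 0)" for s
  obtain N where N: "N \<in> null_sets lebesgue" "{s. \<not> (s \<in> {l<..<r} \<longrightarrow> v differentiable (at s))} \<subseteq> N"
    using diff unfolding eventually_ae_filter by (elim bexE) (simp add: that)
  have "negligible (N \<union> {l, r})"
    using N(1) by (simp add: negligible_iff_null_sets negligible_Un)
  moreover have "{a..b} - D \<subseteq> N \<union> {l, r}"
  proof
    fix x assume x: "x \<in> {a..b} - D"
    show "x \<in> N \<union> {l, r}"
    proof (cases "x = l \<or> x = r")
      case False
      with x ab have "x \<in> {s. \<not> (s \<in> {l<..<r} \<longrightarrow> v differentiable (at s))}"
        by (auto simp: D_def)
      with N(2) show ?thesis by blast
    qed auto
  qed
  ultimately have neg: "negligible ({a..b} - D)"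
    by (rule negligible_subset)
  have "(f has_integral v b - v a) {a..b}"
    unfolding has_integral_real
  proof (intro allI impI)
    fix e :: real assume "e > 0"
    \<comment> \<open>The 1 in the denominator covers the degenerate interval \<open>a = b\<close>.\<close>
    define e1 where "e1 = e / (2 * (1 + (b - a)))"
    have e1: "e1 > 0" "e1 * (b - a) \<le> e / 2"
      using \<open>e > 0\<close> ab by (auto simp: e1_def field_simps)
    have "\<exists>\<delta>>0. \<forall>N (c :: nat \<Rightarrow> real) d.
       (\<forall>i<N. l \<le> c i \<and> c i \<le> d i \<and> d i \<le> r) \<and>
       (\<forall>i<N. \<forall>j<N. i \<noteq> j \<longrightarrow> {c i<..<d i} \<inter> {c j<..<d j} = {}) \<and>
       (\<Sum>i<N. d i - c i) < \<delta> \<longrightarrow> (\<Sum>i<N. \<bar>v (d i) - v (c i)\<bar>) < e / 2"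
      using \<open>e > 0\<close> by (intro ac[unfolded absolutely_continuous_on_def, THEN spec, THEN mp]) simp
    then obtain \<delta> where "\<delta> > 0" and \<delta>: "\<forall>N (c :: nat \<Rightarrow> real) d.
       (\<forall>i<N. l \<le> c i \<and> c i \<le> d i \<and> d i \<le> r) \<and>
       (\<forall>i<N. \<forall>j<N. i \<noteq> j \<longrightarrow> {c i<..<d i} \<inter> {c j<..<d j} = {}) \<and>
       (\<Sum>i<N. d i - c i) < \<delta> \<longrightarrow> (\<Sum>i<N. \<bar>v (d i) - v (c i)\<bar>) < e / 2"
      by (elim exE conjE)
    have nullE: "{a..b} - D \<in> null_sets lebesgue"
      using neg by (simp add: negligible_iff_null_sets)
    obtain V where V: "open V" "{a..b} - D \<subseteq> V" and VD: "V - ({a..b} - D) \<in> lmeasurable"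
        "emeasure lebesgue (V - ({a..b} - D)) < ennreal \<delta>"
      using sets_lebesgue_outer_open[of "{a..b} - D" \<delta>] nullE \<open>\<delta> > 0\<close> by blast
    have Vset: "V \<in> sets lebesgue" using V(1) by (simp add: borel_open)
    have "emeasure lebesgue V < ennreal \<delta>"
      using VD(2) emeasure_Diff_null_set[OF nullE Vset] by simp
    then have V': "V \<in> lmeasurable" "measure lebesgue V < \<delta>"
      using Vset \<open>\<delta> > 0\<close> order.strict_trans[OF _ ennreal_less_top[of \<delta>]]
      by (auto simp add: fmeasurable_def measure_def enn2real_less_iff simp del: emeasure_completion)
    have "\<exists>d>0. (x \<in> D \<longrightarrow> (\<forall>y. \<bar>y - x\<bar> < d \<longrightarrow> \<bar>v y - v x - f x * (y - x)\<bar> \<le> e1 * \<bar>y - x\<bar>)) \<and>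
        (x \<in> V \<longrightarrow> ball x d \<subseteq> V)" for x
    proof -
      have "\<exists>d>0. x \<in> D \<longrightarrow> (\<forall>y. \<bar>y - x\<bar> < d \<longrightarrow> \<bar>v y - v x - f x * (y - x)\<bar> \<le> e1 * \<bar>y - x\<bar>)"
      proof (cases "x \<in> D")
        case True
        then have "(v has_real_derivative f x) (at x)"
          by (simp add: D_def f_def DERIV_deriv_iff_real_differentiable)
        then have "\<forall>e>0. \<exists>d>0. \<forall>y. norm (y - x) < d \<longrightarrow> norm (v y - v x - f x * (y - x)) \<le> e * norm (y - x)"
          unfolding has_field_derivative_def has_derivative_at_alt by simp
        then show ?thesis
          using e1(1) unfolding real_norm_def by blast
      qed (auto intro: zero_less_one)
      then obtain d1 where d1: "d1 > 0" "x \<in> D \<longrightarrow> (\<forall>y. \<bar>y - x\<bar> < d1 \<longrightarrow> \<bar>v y - v x - f x * (y - x)\<bar> \<le> e1 * \<bar>y - x\<bar>)"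
        by blast
      obtain d2 where d2: "d2 > 0" "x \<in> V \<longrightarrow> ball x d2 \<subseteq> V"
        using \<open>open V\<close> by (metis open_contains_ball zero_less_one)
      show ?thesis
        using d1 d2 by (intro exI[of _ "min d1 d2"]) (auto simp: subset_iff)
    qed
    then obtain d where d: "\<And>x. d x > 0"
      "\<And>x y. x \<in> D \<Longrightarrow> \<bar>y - x\<bar> < d x \<Longrightarrow> \<bar>v y - v x - f x * (y - x)\<bar> \<le> e1 * \<bar>y - x\<bar>"
      "\<And>x. x \<in> V \<Longrightarrow> ball x (d x) \<subseteq> V"
      by metis
    show "\<exists>\<gamma>. gauge \<gamma> \<and> (\<forall>p. p tagged_division_of {a..b} \<and> \<gamma> fine p \<longrightarrow>
            norm ((\<Sum>(x, K)\<in>p. measure lborel K *\<^sub>R f x) - (v b - v a)) < e)"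
    proof (intro exI[of _ "\<lambda>x. ball x (d x)"] conjI allI impI, goal_cases)
      case 1
      show ?case using d(1) by (simp add: gauge_ball_dependent)
    next
      case (2 p)
      then have p: "p tagged_division_of {a..b}" and fine: "(\<lambda>x. ball x (d x)) fine p" by auto
      have fin: "finite p" using p by blast
      define p1 where "p1 = {z \<in> p. fst z \<in> D}"
      define p2 where "p2 = {z \<in> p. fst z \<notin> D}"
      have split: "p = p1 \<union> p2" "p1 \<inter> p2 = {}" "finite p1" "finite p2" "p1 \<subseteq> p" "p2 \<subseteq> p"
        using fin by (auto simp: p1_def p2_def)
      have K: "\<exists>c d. K = {c..d} \<and> c \<le> d \<and> x \<in> {c..d} \<and> {c..d} \<subseteq> {a..b} \<and> measure lborel K = d - c \<and> Inf K = c \<and> Sup K = d"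
        if xK: "(x, K) \<in> p" for x K
      proof -
        obtain c d where "K = cbox c d" "x \<in> K" "K \<subseteq> {a..b}" 
          using tagged_division_ofD(2)[OF p xK] tagged_division_ofD(3)[OF p xK] tagged_division_ofD(4)[OF p xK] by metis
        then show ?thesis by - (rule exI[where x = c], rule exI[where x = d], auto)
      qed
      have "v b - v a = (\<Sum>(x,K)\<in>p. v (Sup K) - v (Inf K))"
        using additive_tagged_division_1[OF ab(2) p, of v] by simp
      then have eq: "(\<Sum>(x, K)\<in>p. measure lborel K *\<^sub>R f x) - (v b - v a) =
         (\<Sum>(x,K)\<in>p1. measure lborel K * f x - (v (Sup K) - v (Inf K))) +
         (\<Sum>(x,K)\<in>p2. measure lborel K * f x - (v (Sup K) - v (Inf K)))"
        by (subst sum.union_disjoint[symmetric]) (use split in \<open>auto simp: sum_subtractf case_prod_unfold\<close>)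
      have "\<bar>\<Sum>(x,K)\<in>p1. measure lborel K * f x - (v (Sup K) - v (Inf K))\<bar> \<le> (\<Sum>(x,K)\<in>p1. e1 * measure lborel K)"
        unfolding case_prod_unfold
      proof (rule sum_abs[THEN order_trans], rule sum_mono)
        fix z assume "z \<in> p1"
        obtain x K where z: "z = (x, K)" by (cases z)
        then have xD: "x \<in> D" and xK: "(x, K) \<in> p" using \<open>z \<in> p1\<close> by (auto simp: p1_def)
        from K[OF xK] obtain c c' where c: "K = {c..c'}" "c \<le> x" "x \<le> c'" "measure lborel K = c' - c" "Inf K = c" "Sup K = c'"
          by (metis atLeastAtMost_iff)
        have "c \<in> ball x (d x)" "c' \<in> ball x (d x)" using fineD[OF fine xK] c(1-3) by (simp_all add: subset_iff)
        then have "\<bar>c - x\<bar> < d x" "\<bar>c' - x\<bar> < d x"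
          by (auto simp: dist_real_def abs_minus_commute)
        from d(2)[OF xD this(1)] d(2)[OF xD this(2)]
        have "\<bar>v c - v x - f x * (c - x)\<bar> \<le> e1 * (x - c)" "\<bar>v c' - v x - f x * (c' - x)\<bar> \<le> e1 * (c' - x)"
          using c by auto
        moreover have "(c' - c) * f x - (v c' - v c) = (v c - v x - f x * (c - x)) - (v c' - v x - f x * (c' - x))"
          by (simp add: algebra_simps)
        moreover have "e1 * (c' - c) = e1 * (x - c) + e1 * (c' - x)" by (simp add: algebra_simps)
        ultimately have "\<bar>(c' - c) * f x - (v c' - v c)\<bar> \<le> e1 * (c' - c)" by linarith
        then show "\<bar>measure lborel (snd z) * f (fst z) - (v (Sup (snd z)) - v (Inf (snd z)))\<bar> \<le> e1 * measure lborel (snd z)"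
          using c by (simp add: z)
      qed
      also have "\<dots> \<le> (\<Sum>(x,K)\<in>p. e1 * measure lborel K)"
        using split fin e1 by (intro sum_mono2) (auto)
      also have "\<dots> = e1 * (b - a)"
        using additive_content_tagged_division[of p a b] p ab by (simp add: sum_distrib_left[symmetric] case_prod_unfold)
      finally have B1: "\<bar>\<Sum>(x,K)\<in>p1. measure lborel K * f x - (v (Sup K) - v (Inf K))\<bar> \<le> e / 2"
        using e1 by linarith
      \<comment> \<open>Absolute continuity speaks of finite sequences of intervals, so the tagged intervals with tags
        outside \<open>D\<close> are enumerated.\<close>
      define N where "N = card p2"
      obtain g where g: "bij_betw g {..<N} p2"
        using ex_bij_betw_nat_finite[OF split(4)] by (auto simp: N_def atLeast0LessThan)
      define c where "c i = Inf (snd (g i))" for i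
      define c' where "c' i = Sup (snd (g i))" for i
      have gp: "g i \<in> p2" if "i < N" for i using g that by (auto simp: bij_betw_def)
      have gK: "snd (g i) = {c i..c' i} \<and> c i \<le> c' i \<and> {c i..c' i} \<subseteq> {a..b} \<and> fst (g i) \<in> {c i..c' i}" if "i < N" for i
        using K[of "fst (g i)" "snd (g i)"] gp[OF that] split(6)
        unfolding c_def c'_def by (metis prod.collapse subsetD)
      have disj: "{c i<..<c' i} \<inter> {c j<..<c' j} = {}" if "i < N" "j < N" "i \<noteq> j" for i j
      proof -
        have "g i \<noteq> g j" using g that by (auto simp: bij_betw_def inj_on_def)
        moreover have "(fst (g i), snd (g i)) \<in> p" "(fst (g j), snd (g j)) \<in> p" using gp that split by auto
        ultimately have "interior (snd (g i)) \<inter> interior (snd (g j)) = {}"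
          using tagged_division_ofD(5)[OF p, of "fst (g i)" "snd (g i)" "fst (g j)" "snd (g j)"] 
          by (auto simp: prod_eq_iff)
        then show ?thesis using gK that by simp
      qed
      have sub: "{c i<..<c' i} \<subseteq> V" if "i < N" for i
      proof -
        have "fst (g i) \<in> {a..b} - D" using gp[OF that] gK[OF that] by (auto simp: p2_def)
        then have "fst (g i) \<in> V" using V by auto
        moreover have "snd (g i) \<subseteq> ball (fst (g i)) (d (fst (g i)))"
          using fine gp[OF that] split(6) by (auto simp: fine_def case_prod_unfold)
        ultimately show ?thesis using d(3) gK[OF that] by (smt (verit) greaterThanLessThan_subseteq_atLeastAtMost_iff subset_trans)
      qed
      have "(\<Sum>i<N. c' i - c i) = (\<Sum>i<N. measure lebesgue {c i<..<c' i})"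
        using gK by (intro sum.cong) auto
      also have "\<dots> = measure lebesgue (\<Union>i<N. {c i<..<c' i})"
        using disj by (intro measure_finite_Union[symmetric]) (auto simp: disjoint_family_on_def emeasure_lborel_Ioo gK)
      also have "\<dots> \<le> measure lebesgue V"
        using sub V' by (intro measure_mono_fmeasurable) auto
      finally have "(\<Sum>i<N. c' i - c i) < \<delta>" using V' by simp
      moreover have gK': "l \<le> c i \<and> c i \<le> c' i \<and> c' i \<le> r" if "i < N" for i
        using gK[OF that] ab by auto
      ultimately have "(\<Sum>i<N. \<bar>v (c' i) - v (c i)\<bar>) < e / 2"
        using disj gK' by (intro \<delta>[THEN spec, THEN spec, THEN spec, THEN mp] conjI) auto
      also have "(\<Sum>i<N. \<bar>v (c' i) - v (c i)\<bar>) = (\<Sum>z\<in>p2. \<bar>v (Sup (snd z)) - v (Inf (snd z))\<bar>)"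
        unfolding c_def c'_def by (rule sum.reindex_bij_betw[OF g])
      also have "\<dots> = (\<Sum>(x,K)\<in>p2. \<bar>measure lborel K * f x - (v (Sup K) - v (Inf K))\<bar>)"
        by (intro sum.cong) (auto simp: p2_def f_def)
      finally have "\<bar>\<Sum>(x,K)\<in>p2. measure lborel K * f x - (v (Sup K) - v (Inf K))\<bar> < e / 2"
        unfolding case_prod_unfold using sum_abs by (rule le_less_trans[rotated])
      with B1 show ?case unfolding eq real_norm_def by linarith
    qed
  qed
  then show ?thesis
    by (rule has_integral_spike[OF neg, rotated]) (auto simp: f_def)
qed

section \<open>Mean square convergence\<close>

lemma square_integrable_mult:
  fixes f g :: "'a \<Rightarrow> real"
  assumes [measurable]: "f \<in> borel_measurable M" "g \<in> borel_measurable M"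
    and "integrable M (\<lambda>x. (f x)\<^sup>2)" "integrable M (\<lambda>x. (g x)\<^sup>2)"
  shows "integrable M (\<lambda>x. f x * g x)"
proof (rule Bochner_Integration.integrable_bound)
  show "integrable M (\<lambda>x. (f x)\<^sup>2 + (g x)\<^sup>2)" using assms by simp
  show "AE x in M. norm (f x * g x) \<le> norm ((f x)\<^sup>2 + (g x)\<^sup>2)"
  proof (intro AE_I2)
    fix x
    have "0 \<le> (\<bar>f x\<bar> - \<bar>g x\<bar>)\<^sup>2" "0 \<le> (f x)\<^sup>2 + (g x)\<^sup>2" by simp_all
    then have "2 * (\<bar>f x\<bar> * \<bar>g x\<bar>) \<le> (f x)\<^sup>2 + (g x)\<^sup>2"
      by (simp add: power2_diff)
    moreover have "0 \<le> \<bar>f x\<bar> * \<bar>g x\<bar>" by simp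
    ultimately show "norm (f x * g x) \<le> norm ((f x)\<^sup>2 + (g x)\<^sup>2)"
      unfolding real_norm_def abs_mult by linarith
  qed
qed measurable

lemma square_integrable_diff:
  fixes f g :: "'a \<Rightarrow> real"
  assumes "f \<in> borel_measurable M" "g \<in> borel_measurable M"
    and "integrable M (\<lambda>x. (f x)\<^sup>2)" "integrable M (\<lambda>x. (g x)\<^sup>2)"
  shows "integrable M (\<lambda>x. (f x - g x)\<^sup>2)"
  using assms square_integrable_mult[OF assms] unfolding power2_diff by (simp add: mult.assoc)

text \<open>
  Integrate \<open>(C f - B g)\<^sup>2\<close> with \<open>B = \<integral>f g\<close> and \<open>C = \<integral>g\<^sup>2\<close>. For \<open>C = 0\<close> this says
  nothing, but then \<open>g\<close> vanishes almost everywhere.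
\<close>

lemma integral_Cauchy_Schwarz:
  fixes f g :: "'a \<Rightarrow> real"
  assumes m: "f \<in> borel_measurable M" "g \<in> borel_measurable M"
    and i: "integrable M (\<lambda>x. (f x)\<^sup>2)" "integrable M (\<lambda>x. (g x)\<^sup>2)"
  shows "(LINT x|M. f x * g x)\<^sup>2 \<le> (LINT x|M. (f x)\<^sup>2) * (LINT x|M. (g x)\<^sup>2)"
proof -
  define A B C where "A = (LINT x|M. (f x)\<^sup>2)" and "B = (LINT x|M. f x * g x)" and "C = (LINT x|M. (g x)\<^sup>2)"
  note fg = square_integrable_mult[OF m i]
  have "0 \<le> (LINT x|M. (C * f x - B * g x)\<^sup>2)" by simp
  also have "\<dots> = (LINT x|M. C\<^sup>2 * (f x)\<^sup>2 - 2 * C * B * (f x * g x) + B\<^sup>2 * (g x)\<^sup>2)"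
    by (intro Bochner_Integration.integral_cong) (auto simp: power2_eq_square algebra_simps)
  also have "\<dots> = C\<^sup>2 * A - 2 * C * B * B + B\<^sup>2 * C"
    using i fg by (simp add: A_def B_def C_def)
  also have "\<dots> = C * (A * C - B\<^sup>2)" by (simp add: power2_eq_square algebra_simps)
  finally have *: "0 \<le> C * (A * C - B\<^sup>2)" .
  have "C \<ge> 0" by (simp add: C_def)
  show ?thesis
  proof (cases "C = 0")
    case True
    then have "AE x in M. g x = 0"
      using integral_nonneg_eq_0_iff_AE[OF i(2)] by (simp add: C_def)
    then have "B = (LINT x|M. 0)"
      unfolding B_def using m by (intro integral_cong_AE) auto
    with True show ?thesis by (simp add: B_def C_def)
  next
    case False
    with * \<open>C \<ge> 0\<close> have "0 \<le> A * C - B\<^sup>2" by (simp add: zero_le_mult_iff)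
    then show ?thesis by (simp add: A_def B_def C_def)
  qed
qed

text \<open>
  Square integrability of the limit is part of the conclusion: the distance in the hypothesis is an
  extended nonnegative number, and it is finite from some index on.
\<close>

lemma nn_integral_L2_limit:
  fixes S :: "nat \<Rightarrow> 'a \<Rightarrow> real"
  assumes m: "\<And>m. S m \<in> borel_measurable M" "Y \<in> borel_measurable M"
    and i: "\<And>m. integrable M (\<lambda>x. (S m x)\<^sup>2)"
    and lim: "(\<lambda>m. \<integral>\<^sup>+x. ennreal ((S m x - Y x)\<^sup>2) \<partial>M) \<longlonglongrightarrow> 0"
  shows "integrable M (\<lambda>x. (Y x)\<^sup>2)" and "(\<lambda>m. LINT x|M. (S m x - Y x)\<^sup>2) \<longlonglongrightarrow> 0"
proof -
  note [measurable] = m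
  from order_tendstoD(2)[OF lim, of 1] obtain k where "(\<integral>\<^sup>+x. ennreal ((S k x - Y x)\<^sup>2) \<partial>M) < 1"
    by (auto simp: eventually_sequentially)
  then have "integrable M (\<lambda>x. (S k x - Y x)\<^sup>2)"
    by (intro integrableI_nonneg) (auto intro: order.strict_trans)
  from square_integrable_diff[OF _ _ i[of k] this] show Y: "integrable M (\<lambda>x. (Y x)\<^sup>2)" by simp
  have "(\<integral>\<^sup>+x. ennreal ((S m x - Y x)\<^sup>2) \<partial>M) = ennreal (LINT x|M. (S m x - Y x)\<^sup>2)" for m
    by (intro nn_integral_eq_integral square_integrable_diff i Y) auto
  with lim show "(\<lambda>m. LINT x|M. (S m x - Y x)\<^sup>2) \<longlonglongrightarrow> 0"
    by (simp flip: ennreal_0)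
qed

lemma tendsto_integral_square:
  fixes S :: "nat \<Rightarrow> 'a \<Rightarrow> real"
  assumes m: "\<And>m. S m \<in> borel_measurable M" "Y \<in> borel_measurable M"
    and i: "\<And>m. integrable M (\<lambda>x. (S m x)\<^sup>2)" "integrable M (\<lambda>x. (Y x)\<^sup>2)"
    and lim: "(\<lambda>m. LINT x|M. (S m x - Y x)\<^sup>2) \<longlonglongrightarrow> 0"
  shows "(\<lambda>m. LINT x|M. (S m x)\<^sup>2) \<longlonglongrightarrow> (LINT x|M. (Y x)\<^sup>2)"
proof -
  have d: "integrable M (\<lambda>x. (S m x - Y x)\<^sup>2)" for m
    by (intro square_integrable_diff m i)
  have dm: "(\<lambda>x. S m x - Y x) \<in> borel_measurable M" for m using m by measurable
  have cs: "\<bar>LINT x|M. (S m x - Y x) * Y x\<bar> \<le> sqrt ((LINT x|M. (S m x - Y x)\<^sup>2) * (LINT x|M. (Y x)\<^sup>2))" for m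
    using integral_Cauchy_Schwarz[OF dm m(2) d i(2), of m] by (intro real_le_rsqrt) simp
  have "(\<lambda>m. sqrt ((LINT x|M. (S m x - Y x)\<^sup>2) * (LINT x|M. (Y x)\<^sup>2))) \<longlonglongrightarrow> sqrt (0 * (LINT x|M. (Y x)\<^sup>2))"
    by (intro tendsto_intros lim)
  then have 0: "(\<lambda>m. sqrt ((LINT x|M. (S m x - Y x)\<^sup>2) * (LINT x|M. (Y x)\<^sup>2))) \<longlonglongrightarrow> 0"
    by simp
  have 1: "(\<lambda>m. LINT x|M. (S m x - Y x) * Y x) \<longlonglongrightarrow> 0"
    by (rule Lim_null_comparison[OF always_eventually 0]) (simp only: real_norm_def cs simp_thms)
  have "(LINT x|M. (S m x)\<^sup>2) = (LINT x|M. (S m x - Y x)\<^sup>2 + 2 * ((S m x - Y x) * Y x) + (Y x)\<^sup>2)" for m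
    by (intro Bochner_Integration.integral_cong) (auto simp: power2_eq_square algebra_simps)
  also have "\<dots> m = (LINT x|M. (S m x - Y x)\<^sup>2) + 2 * (LINT x|M. (S m x - Y x) * Y x) + (LINT x|M. (Y x)\<^sup>2)" for m
    using d i(2) square_integrable_mult[OF dm m(2) d i(2)] by simp
  finally show ?thesis
    using tendsto_add[OF tendsto_add[OF lim tendsto_mult[OF tendsto_const[of 2] 1]] tendsto_const[of "LINT x|M. (Y x)\<^sup>2"]]
    by simp
qed

lemma (in prob_space) L2_limit_imp_L1_limit:
  fixes S :: "nat \<Rightarrow> 'a \<Rightarrow> real"
  assumes m: "\<And>m. S m \<in> borel_measurable M" "Y \<in> borel_measurable M"
    and i: "\<And>m. integrable M (\<lambda>x. (S m x)\<^sup>2)" "integrable M (\<lambda>x. (Y x)\<^sup>2)"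
    and lim: "(\<lambda>m. LINT x|M. (S m x - Y x)\<^sup>2) \<longlonglongrightarrow> 0"
  shows "(\<lambda>m. LINT x|M. \<bar>S m x - Y x\<bar>) \<longlonglongrightarrow> 0"
proof -
  have d: "integrable M (\<lambda>x. (S m x - Y x)\<^sup>2)" for m
    by (intro square_integrable_diff m i)
  have dm: "(\<lambda>x. \<bar>S m x - Y x\<bar>) \<in> borel_measurable M" for m using m by measurable
  have cs: "(LINT x|M. \<bar>S m x - Y x\<bar>) \<le> sqrt (LINT x|M. (S m x - Y x)\<^sup>2)" for m
    using integral_Cauchy_Schwarz[OF dm, of "\<lambda>_. 1" m] d[of m] by (intro real_le_rsqrt) (simp add: prob_space)
  have "(\<lambda>m. sqrt (LINT x|M. (S m x - Y x)\<^sup>2)) \<longlonglongrightarrow> sqrt 0"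
    by (intro tendsto_intros lim)
  then have 0: "(\<lambda>m. sqrt (LINT x|M. (S m x - Y x)\<^sup>2)) \<longlonglongrightarrow> 0"
    by simp
  show ?thesis
    by (rule Lim_null_comparison[OF always_eventually 0]) (simp add: cs)
qed

text \<open>
  Both functionals are Lipschitz in \<open>L\<^sup>1\<close>, by \<open>\<bar>exp (i x) - exp (i y)\<bar> \<le> \<bar>x - y\<bar>\<close>.
\<close>

lemma (in prob_space) tendsto_expectation_of_L2:
  fixes S :: "nat \<Rightarrow> 'a \<Rightarrow> real"
  assumes m: "\<And>m. S m \<in> borel_measurable M" "Y \<in> borel_measurable M"
    and i: "\<And>m. integrable M (\<lambda>x. (S m x)\<^sup>2)" "integrable M (\<lambda>x. (Y x)\<^sup>2)"
    and lim: "(\<lambda>m. LINT x|M. (S m x - Y x)\<^sup>2) \<longlonglongrightarrow> 0"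
  shows "(\<lambda>m. LINT x|M. S m x) \<longlonglongrightarrow> (LINT x|M. Y x)"
    and "(\<lambda>m. CLINT x|M. iexp (S m x)) \<longlonglongrightarrow> (CLINT x|M. iexp (Y x))"
proof -
  note [measurable] = m
  have int: "integrable M (S m)" "integrable M Y" for m
    using square_integrable_imp_integrable[OF m(1)] square_integrable_imp_integrable[OF m(2)] i by auto
  note L1 = L2_limit_imp_L1_limit[OF assms]
  show "(\<lambda>m. LINT x|M. S m x) \<longlonglongrightarrow> (LINT x|M. Y x)"
  proof (rule LIM_zero_cancel, rule Lim_null_comparison[OF always_eventually L1], safe)
    fix m
    have "(LINT x|M. S m x) - (LINT x|M. Y x) = (LINT x|M. S m x - Y x)" using int by simp
    then show "norm ((LINT x|M. S m x) - (LINT x|M. Y x)) \<le> (LINT x|M. \<bar>S m x - Y x\<bar>)"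
      using integral_abs_bound[of M "\<lambda>x. S m x - Y x"] by simp
  qed
  have ii: "integrable M (\<lambda>x. iexp (f x))" if "f \<in> borel_measurable M" for f :: "'a \<Rightarrow> real"
    using that by (intro integrable_const_bound[where B = 1]) auto
  show "(\<lambda>m. CLINT x|M. iexp (S m x)) \<longlonglongrightarrow> (CLINT x|M. iexp (Y x))"
  proof (rule LIM_zero_cancel, rule Lim_null_comparison[OF always_eventually L1], safe)
    fix m
    have "(CLINT x|M. iexp (S m x)) - (CLINT x|M. iexp (Y x)) = (CLINT x|M. iexp (S m x) - iexp (Y x))"
      using ii[OF m(1)] ii[OF m(2)] by simp
    also have "norm \<dots> \<le> (LINT x|M. norm (iexp (S m x) - iexp (Y x)))"
      by (rule integral_norm_bound)
    also have "\<dots> \<le> (LINT x|M. \<bar>S m x - Y x\<bar>)"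
    proof (rule integral_mono)
      fix x
      have "iexp (S m x) - iexp (Y x) = iexp (Y x) * (iexp (S m x - Y x) - 1)"
        by (simp add: algebra_simps flip: exp_add)
      then have "norm (iexp (S m x) - iexp (Y x)) = norm (iexp (S m x - Y x) - 1)"
        by (simp add: norm_mult)
      also have "\<dots> \<le> \<bar>S m x - Y x\<bar>" using iexp_approx1[of "S m x - Y x" 0] by simp
      finally show "norm (iexp (S m x) - iexp (Y x)) \<le> \<bar>S m x - Y x\<bar>" .
    qed (use int ii[OF m(1)] ii[OF m(2)] in auto)
    finally show "norm ((CLINT x|M. iexp (S m x)) - (CLINT x|M. iexp (Y x))) \<le> (LINT x|M. \<bar>S m x - Y x\<bar>)" .
  qed
qed


section \<open>Gaussian variables and Wiener integrals of step functions\<close>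

text \<open>
  The formula for the characteristic function also holds for a degenerate variable, which is almost
  surely zero when it is centered.
\<close>

lemma (in prob_space) gaussian_rv_centered:
  assumes g: "gaussian_rv M Z" and mean: "(LINT \<omega>|M. Z \<omega>) = 0"
  shows "integrable M (\<lambda>\<omega>. (Z \<omega>)\<^sup>2)"
    and "(CLINT \<omega>|M. iexp (Z \<omega>)) = exp (- (LINT \<omega>|M. (Z \<omega>)\<^sup>2) / 2)"
proof -
  have [measurable]: "Z \<in> borel_measurable M" using g by (simp add: gaussian_rv_def)
  have "integrable M (\<lambda>\<omega>. (Z \<omega>)\<^sup>2) \<and> (CLINT \<omega>|M. iexp (Z \<omega>)) = exp (- (LINT \<omega>|M. (Z \<omega>)\<^sup>2) / 2)"
  proof (cases "\<exists>m s. 0 < s \<and> distributed M lborel Z (normal_density m s)")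
    case True
    then obtain m s where s: "0 < s" and d: "distributed M lborel Z (normal_density m s)" by blast
    have m: "m = 0" using normal_distributed_expectation[OF s d] mean by simp
    have v: "(LINT \<omega>|M. (Z \<omega>)\<^sup>2) = s\<^sup>2"
      using normal_distributed_variance[OF s d] mean by simp
    have sq: "integrable M (\<lambda>\<omega>. (Z \<omega>)\<^sup>2)"
      using v s not_integrable_integral_eq[of M "\<lambda>\<omega>. (Z \<omega>)\<^sup>2"] by auto
    have d1: "distributed M lborel (\<lambda>\<omega>. Z \<omega> / s) std_normal_density"
      using d normal_standard_normal_convert[OF s, of Z m] m by simp
    have "(CLINT \<omega>|M. iexp (Z \<omega>)) = (CLINT \<omega>|M. iexp (s * (Z \<omega> / s)))"
      using s by simp
    also have "\<dots> = (CLINT x|distr M lborel (\<lambda>\<omega>. Z \<omega> / s). iexp (s * x))"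
      by (subst integral_distr) auto
    also have "distr M lborel (\<lambda>\<omega>. Z \<omega> / s) = std_normal_distribution"
      using distributed_distr_eq_density[OF d1] by simp
    also have "(CLINT x|std_normal_distribution. iexp (s * x)) = exp (- (s^2) / 2)"
      using fun_cong[OF char_std_normal_distribution, of s] unfolding char_def by simp
    finally show ?thesis using sq v by simp
  next
    case False
    with g obtain m where m: "AE \<omega> in M. Z \<omega> = m" by (auto simp: gaussian_rv_def)
    have "(LINT \<omega>|M. Z \<omega>) = (LINT \<omega>|M. m)" using m by (intro integral_cong_AE) auto
    then have "m = 0" using mean by (simp add: prob_space)
    have "integrable M (\<lambda>\<omega>. (Z \<omega>)\<^sup>2) \<longleftrightarrow> integrable M (\<lambda>\<omega>. 0::real)"
      using m \<open>m = 0\<close> by (intro integrable_cong_AE) auto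
    moreover have "(LINT \<omega>|M. (Z \<omega>)\<^sup>2) = (LINT \<omega>|M. 0::real)"
      using m \<open>m = 0\<close> by (intro integral_cong_AE) auto
    moreover have "(CLINT \<omega>|M. iexp (Z \<omega>)) = (CLINT \<omega>|M. 1)"
      using m \<open>m = 0\<close> by (intro integral_cong_AE) auto
    ultimately show ?thesis by (simp add: prob_space)
  qed
  then show "integrable M (\<lambda>\<omega>. (Z \<omega>)\<^sup>2)"
    and "(CLINT \<omega>|M. iexp (Z \<omega>)) = exp (- (LINT \<omega>|M. (Z \<omega>)\<^sup>2) / 2)" by auto
qed

text \<open>
  \<open>Z\<close> is the Wiener integral of \<open>g\<close> with respect to \<open>W\<close>, for \<open>g\<close> in the span of the
  indicators of \<open>{0<..t}\<close>. Indexing the combination by a set of times, in which no time is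
  repeated, matches the finite combinations in the definition of a Gaussian process.
\<close>

definition wiener_pair ::
    "real \<Rightarrow> (real \<Rightarrow> 'a \<Rightarrow> real) \<Rightarrow> ('a \<Rightarrow> real) \<Rightarrow> (real \<Rightarrow> real) \<Rightarrow> bool" where
  "wiener_pair T W Z g \<longleftrightarrow> (\<exists>J c. finite J \<and> J \<subseteq> {0..T} \<and>
     Z = (\<lambda>\<omega>. \<Sum>t\<in>J. c t * W t \<omega>) \<and> g = (\<lambda>s. \<Sum>t\<in>J. c t * indicator {0<..t} s))"

lemma wiener_pair_single:
  assumes "t \<in> {0..T}"
  shows "wiener_pair T W (\<lambda>\<omega>. W t \<omega>) (\<lambda>s. indicator {0<..t} s)"
  unfolding wiener_pair_def using assms
  by (intro exI[of _ "{t}"] exI[of _ "\<lambda>_. 1"]) auto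

lemma wiener_pair_zero: "wiener_pair T W (\<lambda>\<omega>. 0) (\<lambda>s. 0)"
  unfolding wiener_pair_def by (intro exI[of _ "{}"]) auto

lemma wiener_pair_scale:
  assumes "wiener_pair T W Z g"
  shows "wiener_pair T W (\<lambda>\<omega>. a * Z \<omega>) (\<lambda>s. a * g s)"
proof -
  obtain J c where "finite J" "J \<subseteq> {0..T}"
    "Z = (\<lambda>\<omega>. \<Sum>t\<in>J. c t * W t \<omega>)" "g = (\<lambda>s. \<Sum>t\<in>J. c t * indicator {0<..t} s)"
    using assms unfolding wiener_pair_def by blast
  then show ?thesis
    unfolding wiener_pair_def
    by (intro exI[of _ J] exI[of _ "\<lambda>t. a * c t"] conjI) (simp_all only: sum_distrib_left mult.assoc)
qed

lemma wiener_pair_add: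
  assumes "wiener_pair T W Z g" "wiener_pair T W Z' g'"
  shows "wiener_pair T W (\<lambda>\<omega>. Z \<omega> + Z' \<omega>) (\<lambda>s. g s + g' s)"
proof -
  obtain J c where J: "finite J" "J \<subseteq> {0..T}"
    "Z = (\<lambda>\<omega>. \<Sum>t\<in>J. c t * W t \<omega>)" "g = (\<lambda>s. \<Sum>t\<in>J. c t * indicator {0<..t} s)"
    using assms(1) unfolding wiener_pair_def by blast
  obtain J' c' where J': "finite J'" "J' \<subseteq> {0..T}"
    "Z' = (\<lambda>\<omega>. \<Sum>t\<in>J'. c' t * W t \<omega>)" "g' = (\<lambda>s. \<Sum>t\<in>J'. c' t * indicator {0<..t} s)"
    using assms(2) unfolding wiener_pair_def by blast
  define d where "d t = (if t \<in> J then c t else 0) + (if t \<in> J' then c' t else 0)" for t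
  have *: "(\<Sum>t\<in>J. c t * f t) + (\<Sum>t\<in>J'. c' t * f t) = (\<Sum>t\<in>J \<union> J'. d t * f t)" for f :: "real \<Rightarrow> real"
  proof -
    have "(\<Sum>t\<in>J. c t * f t) = (\<Sum>t\<in>J \<union> J'. if t \<in> J then c t * f t else 0)"
      using J J' by (subst sum.If_cases) (auto simp: Int_absorb1 Int_Un_distrib2)
    moreover have "(\<Sum>t\<in>J'. c' t * f t) = (\<Sum>t\<in>J \<union> J'. if t \<in> J' then c' t * f t else 0)"
      using J J' by (subst sum.If_cases) (auto simp: Int_absorb1 Int_Un_distrib2)
    ultimately show ?thesis
      by (auto simp: d_def distrib_right sum.distrib[symmetric] intro!: sum.cong)
  qed
  show ?thesis
    unfolding wiener_pair_def
    using J J' by (intro exI[of _ "J \<union> J'"] exI[of _ d] conjI) (simp_all only: * finite_Un Un_least)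
qed

lemma wiener_pair_sum:
  assumes "finite K" "\<And>k. k \<in> K \<Longrightarrow> wiener_pair T W (Z k) (g k)"
  shows "wiener_pair T W (\<lambda>\<omega>. \<Sum>k\<in>K. Z k \<omega>) (\<lambda>s. \<Sum>k\<in>K. g k s)"
  using assms by (induction K rule: finite_induct) (auto intro: wiener_pair_zero wiener_pair_add)

lemma increasing_times_in_interval:
  fixes \<tau> :: "nat \<Rightarrow> real"
  assumes "0 \<le> \<tau> 0" "\<forall>i<N. \<tau> i \<le> \<tau> (Suc i)" "\<tau> N \<le> T" "i \<le> N"
  shows "\<tau> i \<in> {0..T}"
proof -
  have step: "\<tau> j \<le> \<tau> (Suc j)" if "j < N" for j using assms(2) that by blast
  have "\<tau> 0 \<le> \<tau> i" using assms(4)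
  proof (induction i)
    case (Suc i)
    with step[of i] show ?case by simp
  qed simp
  moreover have "\<tau> i \<le> \<tau> N" using assms(4)
  proof (induction rule: inc_induct)
    case (step j)
    with assms(2) show ?case by (meson order_trans)
  qed simp
  ultimately show ?thesis using assms by auto
qed

lemma wiener_pair_step:
  assumes \<tau>: "0 \<le> \<tau> 0" "\<forall>i<N. \<tau> i \<le> \<tau> (Suc i)" "\<tau> N \<le> T"
  shows "wiener_pair T W (step_integral W N c \<tau>) (step_fun N c \<tau>)"
proof -
  have "wiener_pair T W (\<lambda>\<omega>. \<Sum>i<N. c i * (W (\<tau> (Suc i)) \<omega> + (-1) * W (\<tau> i) \<omega>))
    (\<lambda>s. \<Sum>i<N. c i * (indicator {0<..\<tau> (Suc i)} s + (-1) * indicator {0<..\<tau> i} s))"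
    using increasing_times_in_interval[OF \<tau>]
    by (intro wiener_pair_sum wiener_pair_scale wiener_pair_add wiener_pair_single) auto
  moreover have "(\<Sum>i<N. c i * (indicator {0<..\<tau> (Suc i)} s + (-1) * indicator {0<..\<tau> i} s)) = step_fun N c \<tau> s" for s
    unfolding step_fun_def
  proof (intro sum.cong refl)
    fix i assume "i \<in> {..<N}"
    then have "0 \<le> \<tau> i" "\<tau> i \<le> \<tau> (Suc i)" using increasing_times_in_interval[OF \<tau>, of i] \<tau> by auto
    then show "c i * (indicator {0<..\<tau> (Suc i)} s + (-1) * indicator {0<..\<tau> i} s) = c i * indicator {\<tau> i<..\<tau> (Suc i)} s"
      by (auto simp: indicator_def)
  qed
  ultimately show ?thesis
    by (simp add: step_integral_def[abs_def])
qed

lemma indicator_measurable_lebesgue_on [measurable]: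
  "(indicator {a<..b::real} :: real \<Rightarrow> real) \<in> borel_measurable (lebesgue_on S)"
  by (intro measurable_restrict_space1 borel_measurable_indicator) simp

lemma wiener_pair_integrable:
  assumes "wiener_pair T W Z g"
  shows "g \<in> borel_measurable (lebesgue_on {0..T})" and "integrable (lebesgue_on {0..T}) (\<lambda>s. (g s)\<^sup>2)"
proof -
  obtain J c where J: "finite J" "J \<subseteq> {0..T}"
    "Z = (\<lambda>\<omega>. \<Sum>t\<in>J. c t * W t \<omega>)" "g = (\<lambda>s. \<Sum>t\<in>J. c t * indicator {0<..t} s)"
    using assms unfolding wiener_pair_def by blast
  interpret finite_measure "lebesgue_on {0..T}" by (rule finite_measure_lebesgue_on) auto
  show m: "g \<in> borel_measurable (lebesgue_on {0..T})" unfolding J(4) by (intro borel_measurable_sum borel_measurable_times borel_measurable_const indicator_measurable_lebesgue_on)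
  have "\<bar>g s\<bar> \<le> (\<Sum>t\<in>J. \<bar>c t\<bar>)" for s
    unfolding J(4) by (intro sum_abs[THEN order_trans] sum_mono) (auto simp: indicator_def)
  then have "(g s)\<^sup>2 \<le> (\<Sum>t\<in>J. \<bar>c t\<bar>)\<^sup>2" for s
    using power_mono[of "\<bar>g s\<bar>" _ 2] by simp
  then show "integrable (lebesgue_on {0..T}) (\<lambda>s. (g s)\<^sup>2)"
    using m by (intro integrable_const_bound[where B = "(\<Sum>t\<in>J. \<bar>c t\<bar>)\<^sup>2"]) auto
qed

lemma integral_indicator_times_lebesgue_on:
  fixes s t T :: real
  assumes "s \<in> {0..T}" "t \<in> {0..T}"
  shows "integrable (lebesgue_on {0..T}) (\<lambda>r. indicator {0<..s} r * indicator {0<..t} r :: real)"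
    and "(LINT r|lebesgue_on {0..T}. indicator {0<..s} r * indicator {0<..t} r) = min s t"
proof -
  have *: "indicator {0<..s} r * indicator {0<..t} r = (indicator {0<..min s t} r :: real)" for r
    by (auto simp: indicator_def)
  interpret finite_measure "lebesgue_on {0..T}" by (rule finite_measure_lebesgue_on) auto
  show "integrable (lebesgue_on {0..T}) (\<lambda>r. indicator {0<..s} r * indicator {0<..t} r :: real)"
    unfolding * by (intro integrable_const_bound[where B = 1]) auto
  have "(LINT r|lebesgue_on {0..T}. indicator {0<..s} r * indicator {0<..t} r :: real) = measure (lebesgue_on {0..T}) {0<..min s t}"
    unfolding * using assms by (subst Bochner_Integration.integral_indicator) (auto simp: space_restrict_space intro!: arg_cong[where f="measure _"])
  also have "\<dots> = measure lebesgue {0<..min s t}"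
    using assms by (intro measure_restrict_space) auto
  also have "\<dots> = min s t" using assms by auto
  finally show "(LINT r|lebesgue_on {0..T}. indicator {0<..s} r * indicator {0<..t} r) = min s t" .
qed

lemma brownian_motion_square_integrable:
  assumes "brownian_motion M T \<sigma> W" "t \<in> {0..T}"
  shows "W t \<in> borel_measurable M" "integrable M (\<lambda>\<omega>. (W t \<omega>)\<^sup>2)"
proof -
  interpret prob_space M using assms by (simp add: brownian_motion_def)
  have cg: "centered_gaussian_process M {0..T} W" using assms by (simp add: brownian_motion_def)
  have "gaussian_rv M (\<lambda>\<omega>. \<Sum>t\<in>{t}. 1 * W t \<omega>)" "(LINT \<omega>|M. W t \<omega>) = 0"
    using cg[unfolded centered_gaussian_process_def, THEN conjunct1, THEN spec[of _ "{t}"], THEN spec[of _ "\<lambda>_. 1"]]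
      cg[unfolded centered_gaussian_process_def, THEN conjunct2] assms(2) by auto
  then show "integrable M (\<lambda>\<omega>. (W t \<omega>)\<^sup>2)" "W t \<in> borel_measurable M"
    using gaussian_rv_centered(1)[of "W t"] by (simp_all add: gaussian_rv_def)
qed

text \<open>
  This contains the Ito isometry on step functions. It holds because \<open>min s t\<close>, the covariance of
  \<open>W\<close> up to \<open>\<sigma>\<^sup>2\<close>, is the inner product of the indicators of \<open>{0<..s}\<close> and \<open>{0<..t}\<close>.
\<close>

lemma wiener_pair_gaussian:
  assumes bm: "brownian_motion M T \<sigma> W" and Zg: "wiener_pair T W Z g"
  shows "Z \<in> borel_measurable M" and "integrable M (\<lambda>\<omega>. (Z \<omega>)\<^sup>2)" and "(LINT \<omega>|M. Z \<omega>) = 0"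
    and "(CLINT \<omega>|M. iexp (Z \<omega>)) = exp (- (\<sigma>\<^sup>2 * (LINT s|lebesgue_on {0..T}. (g s)\<^sup>2)) / 2)"
proof -
  interpret prob_space M using bm by (simp add: brownian_motion_def)
  obtain J c where J: "finite J" "J \<subseteq> {0..T}"
    "Z = (\<lambda>\<omega>. \<Sum>t\<in>J. c t * W t \<omega>)" "g = (\<lambda>s. \<Sum>t\<in>J. c t * indicator {0<..t} s)"
    using Zg unfolding wiener_pair_def by blast
  have W: "W t \<in> borel_measurable M" "integrable M (\<lambda>\<omega>. (W t \<omega>)\<^sup>2)" "integrable M (W t)" "(LINT \<omega>|M. W t \<omega>) = 0" if "t \<in> J" for t
  proof -
    have t: "t \<in> {0..T}" using that J by blast
    show 1: "W t \<in> borel_measurable M" "integrable M (\<lambda>\<omega>. (W t \<omega>)\<^sup>2)"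
      using brownian_motion_square_integrable[OF bm t] by auto
    show "integrable M (W t)" using square_integrable_imp_integrable[OF 1] .
    show "(LINT \<omega>|M. W t \<omega>) = 0" using bm t by (simp add: brownian_motion_def centered_gaussian_process_def)
  qed
  have gau: "gaussian_rv M Z"
    using bm J unfolding brownian_motion_def centered_gaussian_process_def by blast
  then show "Z \<in> borel_measurable M" by (simp add: gaussian_rv_def)
  show mean: "(LINT \<omega>|M. Z \<omega>) = 0"
    unfolding J(3) using W by (subst Bochner_Integration.integral_sum) auto
  show "integrable M (\<lambda>\<omega>. (Z \<omega>)\<^sup>2)" by (rule gaussian_rv_centered[OF gau mean])
  have cov: "integrable M (\<lambda>\<omega>. W s \<omega> * W t \<omega>)" "(LINT \<omega>|M. W s \<omega> * W t \<omega>) = \<sigma>\<^sup>2 * min s t" if "s \<in> J" "t \<in> J" for s t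
  proof -
    show "integrable M (\<lambda>\<omega>. W s \<omega> * W t \<omega>)" using that by (intro square_integrable_mult W)
    show "(LINT \<omega>|M. W s \<omega> * W t \<omega>) = \<sigma>\<^sup>2 * min s t" using that J bm unfolding brownian_motion_def by blast
  qed
  have "(LINT \<omega>|M. (Z \<omega>)\<^sup>2) = (LINT \<omega>|M. (\<Sum>s\<in>J. \<Sum>t\<in>J. c s * c t * (W s \<omega> * W t \<omega>)))"
    unfolding J(3) power2_eq_square sum_product by (intro Bochner_Integration.integral_cong refl sum.cong) auto
  also have "\<dots> = (\<Sum>s\<in>J. \<Sum>t\<in>J. c s * c t * (\<sigma>\<^sup>2 * min s t))"
    using cov by (simp add: Bochner_Integration.integral_sum)
  also have "\<dots> = \<sigma>\<^sup>2 * (\<Sum>s\<in>J. \<Sum>t\<in>J. c s * c t * min s t)"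
    by (simp add: sum_distrib_left mult_ac)
  also have "(\<Sum>s\<in>J. \<Sum>t\<in>J. c s * c t * min s t) =
      (LINT r|lebesgue_on {0..T}. (\<Sum>s\<in>J. \<Sum>t\<in>J. c s * c t * (indicator {0<..s} r * indicator {0<..t} r)))"
  proof -
    have ii: "integrable (lebesgue_on {0..T}) (\<lambda>r. c s * c t * (indicator {0<..s} r * indicator {0<..t} r))" if "s \<in> J" "t \<in> J" for s t
      using that J(2) by (intro integrable_mult_right integral_indicator_times_lebesgue_on) auto
    have "(LINT r|lebesgue_on {0..T}. (\<Sum>s\<in>J. \<Sum>t\<in>J. c s * c t * (indicator {0<..s} r * indicator {0<..t} r))) =
        (\<Sum>s\<in>J. LINT r|lebesgue_on {0..T}. (\<Sum>t\<in>J. c s * c t * (indicator {0<..s} r * indicator {0<..t} r)))"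
      by (intro Bochner_Integration.integral_sum Bochner_Integration.integrable_sum ii)
    also have "\<dots> = (\<Sum>s\<in>J. \<Sum>t\<in>J. LINT r|lebesgue_on {0..T}. c s * c t * (indicator {0<..s} r * indicator {0<..t} r))"
      by (intro sum.cong refl Bochner_Integration.integral_sum ii)
    also have "\<dots> = (\<Sum>s\<in>J. \<Sum>t\<in>J. c s * c t * min s t)"
      using J(2) by (intro sum.cong refl) (subst integral_mult_right_zero, subst integral_indicator_times_lebesgue_on, auto)
    finally show ?thesis by (rule sym)
  qed
  also have "\<dots> = (LINT r|lebesgue_on {0..T}. (g r)\<^sup>2)"
    unfolding J(4) power2_eq_square sum_product by (intro Bochner_Integration.integral_cong refl sum.cong) auto
  finally show "(CLINT \<omega>|M. iexp (Z \<omega>)) = exp (- (\<sigma>\<^sup>2 * (LINT s|lebesgue_on {0..T}. (g s)\<^sup>2)) / 2)"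
    using gaussian_rv_centered(2)[OF gau mean] by simp
qed

section \<open>The joint law of stochastic integrals against a drifted Brownian motion\<close>

lemma square_integrable_sum:
  fixes A :: "'k \<Rightarrow> 'a \<Rightarrow> real"
  assumes "finite K" and m: "\<And>k. k \<in> K \<Longrightarrow> A k \<in> borel_measurable M"
    and i: "\<And>k. k \<in> K \<Longrightarrow> integrable M (\<lambda>x. (A k x)\<^sup>2)"
  shows "integrable M (\<lambda>x. (\<Sum>k\<in>K. b k * A k x)\<^sup>2)"
    and "(LINT x|M. (\<Sum>k\<in>K. b k * A k x)\<^sup>2) \<le> (\<Sum>k\<in>K. (b k)\<^sup>2 * (LINT x|M. (A k x)\<^sup>2)) * card K"
proof -
  have le: "(\<Sum>k\<in>K. b k * A k x)\<^sup>2 \<le> (\<Sum>k\<in>K. (b k)\<^sup>2 * (A k x)\<^sup>2) * card K" for x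
    using sum_squared_le_sum_of_squares[of "\<lambda>k. b k * A k x" K] by (simp add: power_mult_distrib)
  have int: "integrable M (\<lambda>x. (\<Sum>k\<in>K. (b k)\<^sup>2 * (A k x)\<^sup>2) * card K)"
    by (intro integrable_mult_left Bochner_Integration.integrable_sum integrable_mult_right i)
  show 1: "integrable M (\<lambda>x. (\<Sum>k\<in>K. b k * A k x)\<^sup>2)"
  proof (rule Bochner_Integration.integrable_bound[OF int])
    show "(\<lambda>x. (\<Sum>k\<in>K. b k * A k x)\<^sup>2) \<in> borel_measurable M"
      by (intro borel_measurable_power borel_measurable_sum borel_measurable_times borel_measurable_const m)
    show "AE x in M. norm ((\<Sum>k\<in>K. b k * A k x)\<^sup>2) \<le> norm ((\<Sum>k\<in>K. (b k)\<^sup>2 * (A k x)\<^sup>2) * card K)"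
      using le by (intro AE_I2) (auto intro: order_trans[OF _ abs_ge_self])
  qed
  have "(LINT x|M. (\<Sum>k\<in>K. b k * A k x)\<^sup>2) \<le> (LINT x|M. (\<Sum>k\<in>K. (b k)\<^sup>2 * (A k x)\<^sup>2) * card K)"
    by (rule integral_mono[OF 1 int le])
  also have "\<dots> = (\<Sum>k\<in>K. (b k)\<^sup>2 * (LINT x|M. (A k x)\<^sup>2)) * card K"
  proof -
    have "(LINT x|M. (\<Sum>k\<in>K. (b k)\<^sup>2 * (A k x)\<^sup>2)) = (\<Sum>k\<in>K. LINT x|M. (b k)\<^sup>2 * (A k x)\<^sup>2)"
      using i by (intro Bochner_Integration.integral_sum integrable_mult_right)
    then show ?thesis by simp
  qed
  finally show "(LINT x|M. (\<Sum>k\<in>K. b k * A k x)\<^sup>2) \<le> (\<Sum>k\<in>K. (b k)\<^sup>2 * (LINT x|M. (A k x)\<^sup>2)) * card K" .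
qed

lemma tendsto_L2_sum:
  fixes A :: "'k \<Rightarrow> nat \<Rightarrow> 'a \<Rightarrow> real"
  assumes "finite K" and "\<And>k m. k \<in> K \<Longrightarrow> A k m \<in> borel_measurable M"
    and "\<And>k m. k \<in> K \<Longrightarrow> integrable M (\<lambda>x. (A k m x)\<^sup>2)"
    and lim: "\<And>k. k \<in> K \<Longrightarrow> (\<lambda>m. LINT x|M. (A k m x)\<^sup>2) \<longlonglongrightarrow> 0"
  shows "(\<lambda>m. LINT x|M. (\<Sum>k\<in>K. b k * A k m x)\<^sup>2) \<longlonglongrightarrow> 0"
proof -
  have "(\<lambda>m. (\<Sum>k\<in>K. (b k)\<^sup>2 * (LINT x|M. (A k m x)\<^sup>2)) * card K) \<longlonglongrightarrow> (\<Sum>k\<in>K. (b k)\<^sup>2 * 0) * card K"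
    by (intro tendsto_intros lim)
  then have 0: "(\<lambda>m. (\<Sum>k\<in>K. (b k)\<^sup>2 * (LINT x|M. (A k m x)\<^sup>2)) * card K) \<longlonglongrightarrow> 0"
    by simp
  show ?thesis
    by (rule Lim_null_comparison[OF always_eventually 0])
      (use square_integrable_sum(2)[OF assms(1), of "\<lambda>k. A k _" M b] assms(2,3) in simp)
qed

lemma H_space_deriv_square_integrable:
  assumes "u \<in> H_space T"
  shows "deriv u \<in> borel_measurable (lebesgue_on {0..T})"
    and "integrable (lebesgue_on {0..T}) (\<lambda>s. (deriv u s)\<^sup>2)"
  using assms
  by (simp_all add: H_space_def set_borel_measurable_def borel_measurable_restrict_space_iff integrable_restrict_space
      set_integrable_def mult.commute)

lemma H_space_increment:
  assumes u: "u \<in> H_space T" and ab: "0 \<le> a" "a \<le> b" "b \<le> T"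
  shows "(LINT s|lebesgue_on {0..T}. indicator {a<..b} s * deriv u s) = u b - u a"
proof -
  interpret finite_measure "lebesgue_on {0..T}" by (rule finite_measure_lebesgue_on) auto
  note d = H_space_deriv_square_integrable[OF u]
  have "integrable (lebesgue_on {0..T}) (deriv u)"
    by (rule square_integrable_imp_integrable[OF d])
  then have i1: "set_integrable lebesgue {0..T} (deriv u)"
    by (subst (asm) integrable_restrict_space) (simp_all add: set_integrable_def)
  have i2: "set_integrable lebesgue {a<..b} (deriv u)"
    by (rule set_integrable_subset[OF i1]) (use ab in auto)
  have "(deriv u has_integral u b - u a) {a..b}"
    using u ab by (intro integral_deriv_of_absolutely_continuous[of 0 T]) (auto simp: H_space_def)
  then have "(deriv u has_integral u b - u a) {a<..b}"
    by (subst has_integral_spike_set_eq[of _ "{a..b}"]) (auto intro: negligible_subset[of "{a}"])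
  then have "(LINT s:{a<..b}|lebesgue. deriv u s) = u b - u a"
    using set_lebesgue_integral_eq_integral(2)[OF i2] by (simp add: integral_unique)
  moreover have "(LINT s|lebesgue_on {0..T}. indicator {a<..b} s * deriv u s) = (LINT s:{a<..b}|lebesgue. deriv u s)"
    unfolding set_lebesgue_integral_def
    using ab by (subst integral_restrict_space) (auto intro!: Bochner_Integration.integral_cong simp: set_lebesgue_integral_def indicator_def)
  ultimately show ?thesis by simp
qed

text \<open>
  The deterministic part of a step integral against the drifted process is controlled by the
  \<open>L\<^sup>2\<close> norm of the integrand, with a constant that does not depend on \<open>\<sigma>\<close>. The bound therefore
  passes to the limit that defines the stochastic integral.
\<close>

lemma step_integral_drift_bound:
  assumes u: "u \<in> H_space T" and \<tau>: "0 \<le> \<tau> 0" "\<forall>i<N. \<tau> i \<le> \<tau> (Suc i)" "\<tau> N \<le> T"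
  shows "(step_integral (\<lambda>t _. u t) N c \<tau> \<omega>)\<^sup>2 \<le>
     (LINT s|lebesgue_on {0..T}. (deriv u s)\<^sup>2) * (LINT s|lebesgue_on {0..T}. (step_fun N c \<tau> s)\<^sup>2)"
proof -
  note d = H_space_deriv_square_integrable[OF u]
  \<comment> \<open>The pair supplies measurability and square integrability of the step function; these do not
    depend on the process.\<close>
  have wp: "wiener_pair T (\<lambda>_ _. 0) (step_integral (\<lambda>_ _. 0) N c \<tau>) (step_fun N c \<tau>)"
    by (rule wiener_pair_step[OF \<tau>])
  note g = wiener_pair_integrable[OF wp]
  have ind: "integrable (lebesgue_on {0..T}) (\<lambda>s. indicator {\<tau> i<..\<tau> (Suc i)} s * deriv u s)" for i
  proof (rule square_integrable_mult[OF _ d(1) _ d(2)])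
    interpret finite_measure "lebesgue_on {0..T}" by (rule finite_measure_lebesgue_on) auto
    show "integrable (lebesgue_on {0..T}) (\<lambda>s. (indicator {\<tau> i<..\<tau> (Suc i)} s)\<^sup>2 :: real)"
      by (intro integrable_const_bound[where B = 1] borel_measurable_power indicator_measurable_lebesgue_on)
        (auto simp: indicator_def)
  qed (rule indicator_measurable_lebesgue_on)
  have "step_integral (\<lambda>t _. u t) N c \<tau> \<omega> = (\<Sum>i<N. c i * (LINT s|lebesgue_on {0..T}. indicator {\<tau> i<..\<tau> (Suc i)} s * deriv u s))"
    unfolding step_integral_def
  proof (intro sum.cong refl)
    fix i assume "i \<in> {..<N}"
    then have "\<tau> i \<in> {0..T}" "\<tau> (Suc i) \<in> {0..T}" "\<tau> i \<le> \<tau> (Suc i)"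
      using increasing_times_in_interval[OF \<tau>] \<tau>(2) by auto
    then show "c i * (u (\<tau> (Suc i)) - u (\<tau> i)) = c i * (LINT s|lebesgue_on {0..T}. indicator {\<tau> i<..\<tau> (Suc i)} s * deriv u s)"
      by (subst H_space_increment[OF u]) auto
  qed
  also have "\<dots> = (LINT s|lebesgue_on {0..T}. (\<Sum>i<N. c i * (indicator {\<tau> i<..\<tau> (Suc i)} s * deriv u s)))"
    by (subst Bochner_Integration.integral_sum) (simp_all only: integrable_mult_right[OF ind] integral_mult_right_zero)
  also have "\<dots> = (LINT s|lebesgue_on {0..T}. deriv u s * step_fun N c \<tau> s)"
    unfolding step_fun_def sum_distrib_left by (simp only: mult_ac)
  finally show ?thesis
    using integral_Cauchy_Schwarz[OF d(1) g(1) d(2) g(2)] by simp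
qed

lemma nn_integral_lebesgue_on:
  assumes "f \<in> borel_measurable (lebesgue_on S)" "S \<in> sets lebesgue"
  shows "(\<integral>\<^sup>+ s. f s \<partial>lebesgue_on S) = (\<integral>\<^sup>+ s\<in>S. f s \<partial>lebesgue)"
  using assms by (intro nn_integral_restrict_space) simp

text \<open>
  The approximating step integrals split into a Wiener integral \<open>S m\<close> of \<open>g m\<close> and a number
  \<open>d m\<close>, the integral of \<open>g m\<close> against the drift.
\<close>

lemma stochastic_integral_approximation:
  assumes bm: "drifted_brownian_motion M T \<sigma> u X" and u: "u \<in> H_space T"
    and f: "f \<in> borel_measurable (lebesgue_on {0..T})" 
    and Y: "is_stochastic_integral M T X f Y"
  shows "\<exists>S g d. (\<forall>m. wiener_pair T (\<lambda>t \<omega>. X t \<omega> - u t) (S m) (g m)) \<and>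
    (\<forall>m. (d m)\<^sup>2 \<le> (LINT s|lebesgue_on {0..T}. (deriv u s)\<^sup>2) * (LINT s|lebesgue_on {0..T}. (g m s)\<^sup>2)) \<and>
    integrable (lebesgue_on {0..T}) (\<lambda>s. (f s)\<^sup>2) \<and>
    (\<lambda>m. LINT s|lebesgue_on {0..T}. (g m s - f s)\<^sup>2) \<longlonglongrightarrow> 0 \<and>
    integrable M (\<lambda>\<omega>. (Y \<omega>)\<^sup>2) \<and>
    (\<lambda>m. LINT \<omega>|M. (S m \<omega> + d m - Y \<omega>)\<^sup>2) \<longlonglongrightarrow> (0::real)"
proof -
  define W where "W t \<omega> = X t \<omega> - u t" for t \<omega>
  have W: "brownian_motion M T \<sigma> W" using bm by (simp add: drifted_brownian_motion_def W_def[abs_def])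
  then interpret prob_space M by (simp add: brownian_motion_def)
  obtain N c \<tau> where \<tau>: "\<And>m. 0 \<le> \<tau> m 0" "\<And>m. \<forall>i<N m. \<tau> m i \<le> \<tau> m (Suc i)" "\<And>m. \<tau> m (N m) \<le> T"
    and L1: "(\<lambda>m. \<integral>\<^sup>+ s\<in>{0..T}. ennreal ((step_fun (N m) (c m) (\<tau> m) s - f s)\<^sup>2) \<partial>lebesgue) \<longlonglongrightarrow> 0"
    and L2: "(\<lambda>m. \<integral>\<^sup>+ \<omega>. ennreal ((step_integral X (N m) (c m) (\<tau> m) \<omega> - Y \<omega>)\<^sup>2) \<partial>M) \<longlonglongrightarrow> 0"
    using Y unfolding is_stochastic_integral_def by blast
  have Ym: "Y \<in> borel_measurable M" using Y by (simp add: is_stochastic_integral_def)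
  define S where "S m = step_integral W (N m) (c m) (\<tau> m)" for m
  define g where "g m = step_fun (N m) (c m) (\<tau> m)" for m
  define d where "d m = step_integral (\<lambda>t _. u t) (N m) (c m) (\<tau> m) ()" for m
  have wp: "wiener_pair T W (S m) (g m)" for m unfolding S_def g_def by (rule wiener_pair_step[OF \<tau>])
  note g = wiener_pair_integrable[OF wp] and SG = wiener_pair_gaussian[OF W wp]
  have "step_integral X (N m) (c m) (\<tau> m) \<omega> = S m \<omega> + d m" for m \<omega>
    by (simp add: S_def d_def step_integral_def W_def sum.distrib[symmetric] algebra_simps)
  with L2 have L2': "(\<lambda>m. \<integral>\<^sup>+ \<omega>. ennreal ((S m \<omega> + d m - Y \<omega>)\<^sup>2) \<partial>M) \<longlonglongrightarrow> 0" by simp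
  have L1': "(\<lambda>m. \<integral>\<^sup>+ s. ennreal ((g m s - f s)\<^sup>2) \<partial>lebesgue_on {0..T}) \<longlonglongrightarrow> 0"
    using L1 f g(1) by (subst nn_integral_lebesgue_on) (simp_all add: g_def)
  have Sd: "integrable M (\<lambda>\<omega>. (S m \<omega> + d m)\<^sup>2)" "(\<lambda>\<omega>. S m \<omega> + d m) \<in> borel_measurable M" for m
    using SG(1,2)[of m] square_integrable_imp_integrable[OF SG(1,2)[of m]] by (simp_all add: power2_sum)
  have "(d m)\<^sup>2 \<le> (LINT s|lebesgue_on {0..T}. (deriv u s)\<^sup>2) * (LINT s|lebesgue_on {0..T}. (g m s)\<^sup>2)" for m
    unfolding d_def g_def by (rule step_integral_drift_bound[OF u \<tau>])
  then show ?thesis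
    using wp nn_integral_L2_limit[OF g(1) f g(2) L1'] nn_integral_L2_limit[OF Sd(2) Ym Sd(1) L2']
    unfolding W_def[abs_def] by blast
qed

text \<open>
  The mean of \<open>Y k\<close> is the limit of the numbers \<open>d k m\<close>, because the Wiener integrals are
  centered. A linear combination of the \<open>Y k\<close> is a mean square limit of Wiener integrals of step
  functions plus numbers, so its characteristic function is the limit of Gaussian ones. Different
  \<open>k\<close> may use different partitions, which is why pairs of variables and integrands are combined
  instead of step functions.
\<close>

lemma stochastic_integrals_gaussian:
  assumes bm: "drifted_brownian_motion M T \<sigma> u X" and u: "u \<in> H_space T" and K: "finite K"
    and f: "\<And>k. k \<in> K \<Longrightarrow> f k \<in> borel_measurable (lebesgue_on {0..T})" 
    and Y: "\<And>k. k \<in> K \<Longrightarrow> is_stochastic_integral M T X (f k) (Y k)"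
  shows "k \<in> K \<Longrightarrow> (LINT \<omega>|M. Y k \<omega>)\<^sup>2 \<le>
      (LINT s|lebesgue_on {0..T}. (deriv u s)\<^sup>2) * (LINT s|lebesgue_on {0..T}. (f k s)\<^sup>2)"
    and "(CLINT \<omega>|M. iexp (\<Sum>k\<in>K. b k * Y k \<omega>)) =
      iexp (\<Sum>k\<in>K. b k * (LINT \<omega>|M. Y k \<omega>)) *
      exp (- (\<sigma>\<^sup>2 * (LINT s|lebesgue_on {0..T}. (\<Sum>k\<in>K. b k * f k s)\<^sup>2)) / 2)"
proof -
  define W where "W t \<omega> = X t \<omega> - u t" for t \<omega>
  have W: "brownian_motion M T \<sigma> W" using bm by (simp add: drifted_brownian_motion_def W_def[abs_def])
  then interpret prob_space M by (simp add: brownian_motion_def)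
  define U where "U = (LINT s|lebesgue_on {0..T}. (deriv u s)\<^sup>2)"
  have Ym: "Y k \<in> borel_measurable M" if "k \<in> K" for k using Y[OF that] by (simp add: is_stochastic_integral_def)
  have "\<forall>k\<in>K. \<exists>S g d. (\<forall>m. wiener_pair T W (S m) (g m)) \<and>
    (\<forall>m. (d m)\<^sup>2 \<le> U * (LINT s|lebesgue_on {0..T}. (g m s)\<^sup>2)) \<and>
    integrable (lebesgue_on {0..T}) (\<lambda>s. (f k s)\<^sup>2) \<and>
    (\<lambda>m. LINT s|lebesgue_on {0..T}. (g m s - f k s)\<^sup>2) \<longlonglongrightarrow> 0 \<and>
    integrable M (\<lambda>\<omega>. (Y k \<omega>)\<^sup>2) \<and>
    (\<lambda>m. LINT \<omega>|M. (S m \<omega> + d m - Y k \<omega>)\<^sup>2) \<longlonglongrightarrow> (0::real)"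
    using stochastic_integral_approximation[OF bm u f Y, folded W_def U_def] by (intro ballI)
  from bchoice[OF this] obtain S where "\<forall>k\<in>K. \<exists>g d. (\<forall>m. wiener_pair T W (S k m) (g m)) \<and>
    (\<forall>m. (d m)\<^sup>2 \<le> U * (LINT s|lebesgue_on {0..T}. (g m s)\<^sup>2)) \<and>
    integrable (lebesgue_on {0..T}) (\<lambda>s. (f k s)\<^sup>2) \<and>
    (\<lambda>m. LINT s|lebesgue_on {0..T}. (g m s - f k s)\<^sup>2) \<longlonglongrightarrow> 0 \<and>
    integrable M (\<lambda>\<omega>. (Y k \<omega>)\<^sup>2) \<and>
    (\<lambda>m. LINT \<omega>|M. (S k m \<omega> + d m - Y k \<omega>)\<^sup>2) \<longlonglongrightarrow> (0::real)" ..
  from bchoice[OF this] obtain g where "\<forall>k\<in>K. \<exists>d. (\<forall>m. wiener_pair T W (S k m) (g k m)) \<and>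
    (\<forall>m. (d m)\<^sup>2 \<le> U * (LINT s|lebesgue_on {0..T}. (g k m s)\<^sup>2)) \<and>
    integrable (lebesgue_on {0..T}) (\<lambda>s. (f k s)\<^sup>2) \<and>
    (\<lambda>m. LINT s|lebesgue_on {0..T}. (g k m s - f k s)\<^sup>2) \<longlonglongrightarrow> 0 \<and>
    integrable M (\<lambda>\<omega>. (Y k \<omega>)\<^sup>2) \<and>
    (\<lambda>m. LINT \<omega>|M. (S k m \<omega> + d m - Y k \<omega>)\<^sup>2) \<longlonglongrightarrow> (0::real)" ..
  from bchoice[OF this] obtain d where approx: "\<forall>k\<in>K. (\<forall>m. wiener_pair T W (S k m) (g k m)) \<and>
    (\<forall>m. (d k m)\<^sup>2 \<le> U * (LINT s|lebesgue_on {0..T}. (g k m s)\<^sup>2)) \<and>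
    integrable (lebesgue_on {0..T}) (\<lambda>s. (f k s)\<^sup>2) \<and>
    (\<lambda>m. LINT s|lebesgue_on {0..T}. (g k m s - f k s)\<^sup>2) \<longlonglongrightarrow> 0 \<and>
    integrable M (\<lambda>\<omega>. (Y k \<omega>)\<^sup>2) \<and>
    (\<lambda>m. LINT \<omega>|M. (S k m \<omega> + d k m - Y k \<omega>)\<^sup>2) \<longlonglongrightarrow> (0::real)" ..
  have wp: "\<And>k m. k \<in> K \<Longrightarrow> wiener_pair T W (S k m) (g k m)"
    and d: "\<And>k m. k \<in> K \<Longrightarrow> (d k m)\<^sup>2 \<le> U * (LINT s|lebesgue_on {0..T}. (g k m s)\<^sup>2)"
    and fi: "\<And>k. k \<in> K \<Longrightarrow> integrable (lebesgue_on {0..T}) (\<lambda>s. (f k s)\<^sup>2)"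
    and gl: "\<And>k. k \<in> K \<Longrightarrow> (\<lambda>m. LINT s|lebesgue_on {0..T}. (g k m s - f k s)\<^sup>2) \<longlonglongrightarrow> 0"
    and Yi: "\<And>k. k \<in> K \<Longrightarrow> integrable M (\<lambda>\<omega>. (Y k \<omega>)\<^sup>2)"
    and Sl: "\<And>k. k \<in> K \<Longrightarrow> (\<lambda>m. LINT \<omega>|M. (S k m \<omega> + d k m - Y k \<omega>)\<^sup>2) \<longlonglongrightarrow> 0"
    using approx by blast+
  note g = wiener_pair_integrable[OF wp] and SG = wiener_pair_gaussian[OF W wp]
  have Si: "integrable M (S k m)" if "k \<in> K" for k m
    by (rule square_integrable_imp_integrable[OF SG(1,2)[OF that]])
  have Sd: "(\<lambda>\<omega>. S k m \<omega> + d k m) \<in> borel_measurable M" "integrable M (\<lambda>\<omega>. (S k m \<omega> + d k m)\<^sup>2)" if "k \<in> K" for k m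
    using SG(1,2)[OF that, of m] Si[OF that, of m] by (simp_all add: power2_sum)
  have dl: "d k \<longlonglongrightarrow> (LINT \<omega>|M. Y k \<omega>)" if k: "k \<in> K" for k
  proof -
    have "(LINT \<omega>|M. S k m \<omega> + d k m) = d k m" for m
      using Si[OF k] SG(3)[OF k] by (simp add: prob_space)
    then show ?thesis
      using tendsto_expectation_of_L2(1)[OF Sd(1)[OF k] Ym[OF k] Sd(2)[OF k] Yi[OF k] Sl[OF k]] by simp
  qed
  show "(LINT \<omega>|M. Y k \<omega>)\<^sup>2 \<le> (LINT s|lebesgue_on {0..T}. (deriv u s)\<^sup>2) * (LINT s|lebesgue_on {0..T}. (f k s)\<^sup>2)"
    if k: "k \<in> K"
    unfolding U_def[symmetric]
  proof (rule LIMSEQ_le)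
    show "(\<lambda>m. (d k m)\<^sup>2) \<longlonglongrightarrow> (LINT \<omega>|M. Y k \<omega>)\<^sup>2" by (intro tendsto_intros dl k)
    show "(\<lambda>m. U * (LINT s|lebesgue_on {0..T}. (g k m s)\<^sup>2)) \<longlonglongrightarrow> U * (LINT s|lebesgue_on {0..T}. (f k s)\<^sup>2)"
      by (intro tendsto_intros tendsto_integral_square g k f fi gl)
    show "\<exists>N. \<forall>m\<ge>N. (d k m)\<^sup>2 \<le> U * (LINT s|lebesgue_on {0..T}. (g k m s)\<^sup>2)" using d[OF k] by blast
  qed
  define Z where "Z m \<omega> = (\<Sum>k\<in>K. b k * S k m \<omega>)" for m \<omega>
  define G where "G m s = (\<Sum>k\<in>K. b k * g k m s)" for m s
  define D where "D m = (\<Sum>k\<in>K. b k * d k m)" for m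
  define v where "v = (LINT s|lebesgue_on {0..T}. (\<Sum>k\<in>K. b k * f k s)\<^sup>2)"
  have ZG: "wiener_pair T W (Z m) (G m)" for m
    unfolding Z_def[abs_def] G_def[abs_def] by (intro wiener_pair_sum wiener_pair_scale wp K)
  have ZD: "Z m \<omega> + D m = (\<Sum>k\<in>K. b k * (S k m \<omega> + d k m))" for m \<omega>
    by (simp add: Z_def D_def sum.distrib algebra_simps)
  have "(\<lambda>m. LINT \<omega>|M. (\<Sum>k\<in>K. b k * (S k m \<omega> + d k m - Y k \<omega>))\<^sup>2) \<longlonglongrightarrow> 0"
    by (intro tendsto_L2_sum K square_integrable_diff borel_measurable_diff Sd Ym Yi Sl)
  then have Zl: "(\<lambda>m. LINT \<omega>|M. (Z m \<omega> + D m - (\<Sum>k\<in>K. b k * Y k \<omega>))\<^sup>2) \<longlonglongrightarrow> 0"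
    by (simp add: ZD sum_subtractf[symmetric] right_diff_distrib)
  have "(\<lambda>m. LINT s|lebesgue_on {0..T}. (\<Sum>k\<in>K. b k * (g k m s - f k s))\<^sup>2) \<longlonglongrightarrow> 0"
    by (intro tendsto_L2_sum K square_integrable_diff borel_measurable_diff g f fi gl)
  then have Gl: "(\<lambda>m. LINT s|lebesgue_on {0..T}. (G m s - (\<Sum>k\<in>K. b k * f k s))\<^sup>2) \<longlonglongrightarrow> 0"
    by (simp add: G_def sum_subtractf[symmetric] right_diff_distrib)
  have vl: "(\<lambda>m. LINT s|lebesgue_on {0..T}. (G m s)\<^sup>2) \<longlonglongrightarrow> v"
    unfolding v_def
    by (intro tendsto_integral_square wiener_pair_integrable[OF ZG] square_integrable_sum K f fi Gl
        borel_measurable_sum borel_measurable_times borel_measurable_const)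
  have "(CLINT \<omega>|M. iexp (Z m \<omega> + D m)) = iexp (D m) * exp (- (\<sigma>\<^sup>2 * (LINT s|lebesgue_on {0..T}. (G m s)\<^sup>2)) / 2)" for m
  proof -
    have "(CLINT \<omega>|M. iexp (Z m \<omega> + D m)) = (CLINT \<omega>|M. iexp (D m) * iexp (Z m \<omega>))"
      by (simp add: algebra_simps flip: exp_add)
    also have "\<dots> = iexp (D m) * (CLINT \<omega>|M. iexp (Z m \<omega>))" by simp
    finally show ?thesis by (simp only: wiener_pair_gaussian(4)[OF W ZG])
  qed
  moreover have "(\<lambda>m. iexp (D m) * exp (- (\<sigma>\<^sup>2 * (LINT s|lebesgue_on {0..T}. (G m s)\<^sup>2)) / 2)) \<longlonglongrightarrow>
      iexp (\<Sum>k\<in>K. b k * (LINT \<omega>|M. Y k \<omega>)) * complex_of_real (exp (- (\<sigma>\<^sup>2 * v) / 2))"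
    unfolding D_def by (intro tendsto_intros vl dl) auto
  moreover have "(\<lambda>m. CLINT \<omega>|M. iexp (Z m \<omega> + D m)) \<longlonglongrightarrow> (CLINT \<omega>|M. iexp (\<Sum>k\<in>K. b k * Y k \<omega>))"
  proof (rule tendsto_expectation_of_L2(2)[OF _ _ _ _ Zl])
    show "(\<lambda>\<omega>. Z m \<omega> + D m) \<in> borel_measurable M" for m
      unfolding ZD by (intro borel_measurable_sum borel_measurable_times borel_measurable_const Sd)
    show "integrable M (\<lambda>\<omega>. (Z m \<omega> + D m)\<^sup>2)" for m
      unfolding ZD by (intro square_integrable_sum K Sd)
    show "(\<lambda>\<omega>. \<Sum>k\<in>K. b k * Y k \<omega>) \<in> borel_measurable M"
      by (intro borel_measurable_sum borel_measurable_times borel_measurable_const Ym)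
    show "integrable M (\<lambda>\<omega>. (\<Sum>k\<in>K. b k * Y k \<omega>)\<^sup>2)"
      by (intro square_integrable_sum K Ym Yi)
  qed
  ultimately show "(CLINT \<omega>|M. iexp (\<Sum>k\<in>K. b k * Y k \<omega>)) =
      iexp (\<Sum>k\<in>K. b k * (LINT \<omega>|M. Y k \<omega>)) *
      exp (- (\<sigma>\<^sup>2 * (LINT s|lebesgue_on {0..T}. (\<Sum>k\<in>K. b k * f k s)\<^sup>2)) / 2)"
    unfolding v_def[symmetric] by (simp only: LIMSEQ_unique)
qed

section \<open>The trigonometric basis\<close>

lemma continuous_lebesgue_on_integral:
  fixes f :: "real \<Rightarrow> real"
  assumes "continuous_on {a..b} f"
  shows "integrable (lebesgue_on {a..b}) f" and "(LINT t|lebesgue_on {a..b}. f t) = integral {a..b} f"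
proof -
  show "integrable (lebesgue_on {a..b}) f" using assms by (rule continuous_imp_integrable_real)
  then show "(LINT t|lebesgue_on {a..b}. f t) = integral {a..b} f"
    by (rule lebesgue_integral_eq_integral) simp
qed

lemma integral_cos_int:
  fixes T :: real and i :: int
  assumes "T > 0"
  shows "(LINT t|lebesgue_on {0..T}. cos (of_int i * (pi * t / T))) = (if i = 0 then T else 0)"
proof (cases "i = 0")
  case True
  have "(LINT t|lebesgue_on {0..T}. cos (of_int i * (pi * t / T))) = integral {0..T} (\<lambda>t. cos (of_int i * (pi * t / T)))"
    using assms by (intro continuous_lebesgue_on_integral continuous_intros) auto
  then show ?thesis using True assms by simp
next
  case False
  define a where "a = of_int i * pi / T"
  have a: "a \<noteq> 0" "of_int i * (pi * t / T) = a * t" for t using False assms by (auto simp: a_def)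
  have "((\<lambda>t. cos (a * t)) has_integral sin (a * T) / a - sin (a * 0) / a) {0..T}"
    using assms a(1)
    by (intro fundamental_theorem_of_calculus) (auto intro!: derivative_eq_intros simp: has_real_derivative_iff_has_vector_derivative[symmetric])
  moreover have "sin (a * T) = 0"
    using assms by (simp add: a_def sin_zero_iff_int2)
  moreover have "(LINT t|lebesgue_on {0..T}. cos (a * t)) = integral {0..T} (\<lambda>t. cos (a * t))"
    by (intro continuous_lebesgue_on_integral continuous_intros)
  ultimately show ?thesis using False unfolding a(2) by (simp add: integral_unique)
qed

text \<open>
  The product formulas reduce both integrals to integer frequencies \<open>j - k\<close> and \<open>j + k - 1\<close>, and
  the latter is nonzero.
\<close>

lemma
  fixes T :: real and j k :: nat
  assumes "T > 0" "j \<ge> 1" "k \<ge> 1"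
  shows integral_cos_cos: "(LINT t|lebesgue_on {0..T}. cos ((real j - 1/2) * (pi * t / T)) * cos ((real k - 1/2) * (pi * t / T)))
      = (if j = k then T / 2 else 0)" (is "?A = _")
    and integral_sin_sin: "(LINT t|lebesgue_on {0..T}. sin ((real j - 1/2) * (pi * t / T)) * sin ((real k - 1/2) * (pi * t / T)))
      = (if j = k then T / 2 else 0)" (is "?B = _")
proof -
  define I where "I i = (LINT t|lebesgue_on {0..T}. cos (of_int i * (pi * t / T)))" for i :: int
  have int: "integrable (lebesgue_on {0..T}) (\<lambda>t. cos (of_int i * (pi * t / T)))" for i :: int
    using assms by (intro continuous_lebesgue_on_integral continuous_intros) auto
  have d: "(real j - 1/2) * x - (real k - 1/2) * x = of_int (int j - int k) * x"
    "(real j - 1/2) * x + (real k - 1/2) * x = of_int (int j + int k - 1) * x" for x :: real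
    by (simp_all add: algebra_simps)
  have "?A = (LINT t|lebesgue_on {0..T}. (cos (of_int (int j - int k) * (pi * t / T)) + cos (of_int (int j + int k - 1) * (pi * t / T))) / 2)"
    unfolding cos_times_cos d ..
  also have "\<dots> = (I (int j - int k) + I (int j + int k - 1)) / 2"
    unfolding I_def by (simp only: integral_divide_zero Bochner_Integration.integral_add[OF int int])
  finally show "?A = (if j = k then T / 2 else 0)"
    using assms unfolding I_def integral_cos_int[OF assms(1)] by auto
  have "?B = (LINT t|lebesgue_on {0..T}. (cos (of_int (int j - int k) * (pi * t / T)) - cos (of_int (int j + int k - 1) * (pi * t / T))) / 2)"
    unfolding sin_times_sin d ..
  also have "\<dots> = (I (int j - int k) - I (int j + int k - 1)) / 2"
    unfolding I_def by (simp only: integral_divide_zero Bochner_Integration.integral_diff[OF int int])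
  finally show "?B = (if j = k then T / 2 else 0)"
    using assms unfolding I_def integral_cos_int[OF assms(1)] by auto
qed

lemma deriv_h_basis:
  assumes "\<sigma> > 0" "T > 0" "k \<ge> 1"
  shows "deriv (h_basis \<sigma> T k) = (\<lambda>t. sqrt (2 * T) / (\<sigma> * T) * cos ((real k - 1 / 2) * (pi * t / T)))"
proof
  fix t
  have k: "real k - 1/2 \<noteq> 0" using assms(3) by linarith
  have "(h_basis \<sigma> T k has_real_derivative 
     sqrt (2 * T) / (\<sigma> * pi * (real k - 1 / 2)) * (cos ((real k - 1 / 2) * (pi * t / T)) * ((real k - 1 / 2) * (pi / T)))) (at t)"
    unfolding h_basis_def[abs_def]
    by (intro DERIV_cmult DERIV_chain2[OF DERIV_sin] DERIV_cdivide) (auto intro!: derivative_eq_intros)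
  also have "sqrt (2 * T) / (\<sigma> * pi * (real k - 1 / 2)) * (cos ((real k - 1 / 2) * (pi * t / T)) * ((real k - 1 / 2) * (pi / T)))
     = sqrt (2 * T) / (\<sigma> * T) * cos ((real k - 1 / 2) * (pi * t / T))"
  proof -
    have "s / (\<sigma> * pi * m) * (c * (m * (pi / T))) = s / (\<sigma> * T) * c" if "m \<noteq> 0" for s m c :: real
      using assms that by (simp add: divide_simps)
    then show ?thesis using k by blast
  qed
  finally show "deriv (h_basis \<sigma> T k) t = sqrt (2 * T) / (\<sigma> * T) * cos ((real k - 1 / 2) * (pi * t / T))"
    by (rule DERIV_imp_deriv)
qed

lemma deriv_h_basis_integrable:
  assumes "\<sigma> > 0" "T > 0" "j \<ge> 1" "k \<ge> 1"
  shows "deriv (h_basis \<sigma> T k) \<in> borel_measurable (lebesgue_on {0..T})"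
    and "integrable (lebesgue_on {0..T}) (\<lambda>t. deriv (h_basis \<sigma> T j) t * deriv (h_basis \<sigma> T k) t)"
    and "(LINT t|lebesgue_on {0..T}. deriv (h_basis \<sigma> T j) t * deriv (h_basis \<sigma> T k) t) = (if j = k then 1 / \<sigma>\<^sup>2 else 0)"
proof -
  have c: "continuous_on {0..T} (deriv (h_basis \<sigma> T k))" if "k \<ge> 1" for k
    unfolding deriv_h_basis[OF assms(1,2) that] using assms by (intro continuous_intros) auto
  show "deriv (h_basis \<sigma> T k) \<in> borel_measurable (lebesgue_on {0..T})"
    using continuous_lebesgue_on_integral(1)[OF c[OF assms(4)]] by (rule borel_measurable_integrable)
  show "integrable (lebesgue_on {0..T}) (\<lambda>t. deriv (h_basis \<sigma> T j) t * deriv (h_basis \<sigma> T k) t)"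
    by (intro continuous_lebesgue_on_integral continuous_on_mult c assms)
  have "(LINT t|lebesgue_on {0..T}. deriv (h_basis \<sigma> T j) t * deriv (h_basis \<sigma> T k) t) =
    (LINT t|lebesgue_on {0..T}. (sqrt (2 * T) / (\<sigma> * T))\<^sup>2 * (cos ((real j - 1/2) * (pi * t / T)) * cos ((real k - 1/2) * (pi * t / T))))"
    unfolding deriv_h_basis[OF assms(1,2,3)] deriv_h_basis[OF assms(1,2,4)] power2_eq_square
    by (intro Bochner_Integration.integral_cong refl) (simp only: mult_ac)
  also have "\<dots> = (sqrt (2 * T) / (\<sigma> * T))\<^sup>2 * (if j = k then T / 2 else 0)"
    unfolding integral_cos_cos[OF assms(2-4), symmetric] by (rule integral_mult_right_zero)
  also have "(sqrt (2 * T) / (\<sigma> * T))\<^sup>2 = 2 / (\<sigma>\<^sup>2 * T)"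
    using assms by (simp add: power_divide power_mult_distrib power2_eq_square)
  finally show "(LINT t|lebesgue_on {0..T}. deriv (h_basis \<sigma> T j) t * deriv (h_basis \<sigma> T k) t) = (if j = k then 1 / \<sigma>\<^sup>2 else 0)"
    using assms by simp
qed

lemma deriv_h_basis_combination:
  assumes "\<sigma> > 0" "T > 0"
  shows "\<sigma>\<^sup>2 * (LINT t|lebesgue_on {0..T}. (\<Sum>k=1..n. b k * deriv (h_basis \<sigma> T k) t)\<^sup>2) = (\<Sum>k=1..n. (b k)\<^sup>2)"
proof -
  note h = deriv_h_basis_integrable[OF assms]
  define h' where "h' k = deriv (h_basis \<sigma> T k)" for k
  have ii: "integrable (lebesgue_on {0..T}) (\<lambda>t. b j * b k * (h' j t * h' k t))"
    if "j \<in> {1..n}" "k \<in> {1..n}" for j k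
    using that unfolding h'_def by (intro integrable_mult_right h) auto
  have "(LINT t|lebesgue_on {0..T}. (\<Sum>k=1..n. b k * h' k t)\<^sup>2) =
     (LINT t|lebesgue_on {0..T}. (\<Sum>j=1..n. \<Sum>k=1..n. b j * b k * (h' j t * h' k t)))"
    unfolding power2_eq_square sum_product by (intro Bochner_Integration.integral_cong refl sum.cong) (simp only: mult_ac)
  also have "\<dots> = (\<Sum>j=1..n. LINT t|lebesgue_on {0..T}. (\<Sum>k=1..n. b j * b k * (h' j t * h' k t)))"
    by (intro Bochner_Integration.integral_sum Bochner_Integration.integrable_sum ii)
  also have "\<dots> = (\<Sum>j=1..n. \<Sum>k=1..n. LINT t|lebesgue_on {0..T}. b j * b k * (h' j t * h' k t))"
    by (intro sum.cong refl Bochner_Integration.integral_sum ii)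
  also have "\<dots> = (\<Sum>j=1..n. \<Sum>k=1..n. b j * b k * (if j = k then 1 / \<sigma>\<^sup>2 else 0))"
    unfolding h'_def by (intro sum.cong refl) (subst integral_mult_right_zero, subst h(3), auto)
  also have "\<dots> = (\<Sum>j=1..n. (b j)\<^sup>2 / \<sigma>\<^sup>2)"
    by (intro sum.cong refl) (simp add: sum.delta' power2_eq_square if_distrib cong: if_cong)
  also have "\<dots> = (\<Sum>j=1..n. (b j)\<^sup>2) / \<sigma>\<^sup>2" by (simp add: sum_divide_distrib)
  finally show ?thesis using assms by (simp add: h'_def)
qed

lemma lam_pos: "\<sigma> > 0 \<Longrightarrow> T > 0 \<Longrightarrow> k \<ge> 1 \<Longrightarrow> lam \<sigma> T k > 0"
  unfolding lam_def by (intro divide_pos_pos mult_pos_pos) auto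

lemma Gam_h_basis_orthogonal:
  assumes "\<sigma> > 0" "T > 0" "j \<ge> 1" "k \<ge> 1"
  shows "integrable (lebesgue_on {0..T}) (\<lambda>t. Gam \<sigma> (h_basis \<sigma> T j) t * Gam \<sigma> (h_basis \<sigma> T k) t)"
    and "(LINT t|lebesgue_on {0..T}. Gam \<sigma> (h_basis \<sigma> T j) t * Gam \<sigma> (h_basis \<sigma> T k) t) = (if j = k then (lam \<sigma> T k)\<^sup>2 else 0)"
proof -
  define C where "C k = \<sigma>\<^sup>2 * (sqrt (2 * T) / (\<sigma> * pi * (real k - 1 / 2)))" for k
  have G: "Gam \<sigma> (h_basis \<sigma> T k) t = C k * sin ((real k - 1 / 2) * (pi * t / T))" for k t
    by (simp add: Gam_def h_basis_def C_def)
  show "integrable (lebesgue_on {0..T}) (\<lambda>t. Gam \<sigma> (h_basis \<sigma> T j) t * Gam \<sigma> (h_basis \<sigma> T k) t)"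
    unfolding G using assms by (intro continuous_lebesgue_on_integral continuous_intros) auto
  have "(LINT t|lebesgue_on {0..T}. Gam \<sigma> (h_basis \<sigma> T j) t * Gam \<sigma> (h_basis \<sigma> T k) t) =
    (LINT t|lebesgue_on {0..T}. (C j * C k) * (sin ((real j - 1/2) * (pi * t / T)) * sin ((real k - 1/2) * (pi * t / T))))"
    unfolding G by (intro Bochner_Integration.integral_cong refl) (simp only: mult_ac)
  also have "\<dots> = (C j * C k) * (if j = k then T / 2 else 0)"
    unfolding integral_sin_sin[OF assms(2-4), symmetric] by (rule integral_mult_right_zero)
  also have "\<dots> = (if j = k then (lam \<sigma> T k)\<^sup>2 else 0)"
  proof -
    have k: "real k - 1/2 \<noteq> 0" using assms(4) by linarith
    have "(C k)\<^sup>2 * T / 2 = (lam \<sigma> T k)\<^sup>2"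
      using assms k by (simp add: C_def lam_def power_divide power_mult_distrib) (simp add: divide_simps power2_eq_square power4_eq_xxxx)
    then show ?thesis by (simp add: power2_eq_square)
  qed
  finally show "(LINT t|lebesgue_on {0..T}. Gam \<sigma> (h_basis \<sigma> T j) t * Gam \<sigma> (h_basis \<sigma> T k) t) = (if j = k then (lam \<sigma> T k)\<^sup>2 else 0)" .
qed

section \<open>The Laplacian of the Stein-type functional\<close>

lemma weighted_square_sum_update:
  fixes w :: "nat \<Rightarrow> real"
  assumes "i \<in> {1..n}"
  shows "(\<Sum>k=1..n. ((y(i := r)) k)\<^sup>2 / w k) = r\<^sup>2 / w i + (\<Sum>k\<in>{1..n} - {i}. (y k)\<^sup>2 / w k)"
proof -
  have "(\<Sum>k=1..n. ((y(i := r)) k)\<^sup>2 / w k) = ((y(i := r)) i)\<^sup>2 / w i + (\<Sum>k\<in>{1..n} - {i}. ((y(i := r)) k)\<^sup>2 / w k)"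
    using assms by (intro sum.remove) auto
  also have "(\<Sum>k\<in>{1..n} - {i}. ((y(i := r)) k)\<^sup>2 / w k) = (\<Sum>k\<in>{1..n} - {i}. (y k)\<^sup>2 / w k)"
    by (intro sum.cong) auto
  finally show ?thesis by simp
qed

lemma DERIV_weighted_square_sum_powr:
  fixes w :: "nat \<Rightarrow> real"
  assumes i: "i \<in> {1..n}" and pos: "(\<Sum>k=1..n. (y k)\<^sup>2 / w k) > 0"
  shows "((\<lambda>r. (\<Sum>k=1..n. ((y(i := r)) k)\<^sup>2 / w k) powr p) has_real_derivative
      p * (\<Sum>k=1..n. (y k)\<^sup>2 / w k) powr (p - 1) * (2 * y i / w i)) (at (y i))"
proof -
  define R where "R = (\<Sum>k\<in>{1..n} - {i}. (y k)\<^sup>2 / w k)"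
  have Q: "(\<Sum>k=1..n. (y k)\<^sup>2 / w k) = (y i)\<^sup>2 / w i + R"
    using weighted_square_sum_update[OF i, of y "y i" w] by (simp add: R_def)
  have "((\<lambda>r. r\<^sup>2 / w i + R) has_real_derivative 2 * y i / w i) (at (y i))"
    by (cases "w i = 0") (auto intro!: derivative_eq_intros)
  from DERIV_fun_powr[OF this, of p] pos show ?thesis
    unfolding weighted_square_sum_update[OF i] R_def[symmetric] Q by simp
qed

text \<open>
  Let \<open>Q\<close> be the quadratic form, so that \<open>sqrt F = Q powr a\<close> with \<open>a = (2 - n) / 4\<close>. By
  orthogonality of the \<open>\<Gamma>h\<^sub>k\<close>, whose squared norms \<open>\<lambda>\<^sub>k\<^sup>2\<close> cancel the weights of \<open>Q\<close>,
  the Laplacian is \<open>(4 a (a - 1) + 2 a n) Q powr (a - 1)\<close>, and the coefficient equals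
  \<open>- (n - 2)\<^sup>2 / 4\<close>.
\<close>

lemma malliavin_laplacian_sqrt_F_stein:
  assumes \<sigma>: "\<sigma> > 0" and T: "T > 0" and n: "n \<ge> 1"
    and pos: "(\<Sum>k=1..n. (x k)\<^sup>2 / (lam \<sigma> T k)\<^sup>2) > 0"
  shows "malliavin_laplacian T \<sigma> n (h_basis \<sigma> T) (\<lambda>x. sqrt (F_stein \<sigma> T n x)) x / sqrt (F_stein \<sigma> T n x)
     = - ((real n - 2)\<^sup>2 / 4) / (\<Sum>k=1..n. (x k)\<^sup>2 / (lam \<sigma> T k)\<^sup>2)"
proof -
  define w where "w k = (lam \<sigma> T k)\<^sup>2" for k
  define Q where "Q y = (\<Sum>k=1..n. (y k)\<^sup>2 / w k)" for y :: "nat \<Rightarrow> real"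
  define a where "a = (2 - real n) / 4"
  define G where "G = (\<lambda>k. Gam \<sigma> (h_basis \<sigma> T k))"
  have w: "w k > 0" if "k \<in> {1..n}" for k
    using lam_pos[OF \<sigma> T, of k] that by (simp add: w_def)
  have Qx: "Q x > 0" using pos by (simp add: Q_def w_def)
  have Q0: "Q y \<ge> 0" for y unfolding Q_def by (intro sum_nonneg) (simp add: w_def)
  have g: "(\<lambda>x. sqrt (F_stein \<sigma> T n x)) = (\<lambda>y. Q y powr a)"
  proof
    fix y
    have "2 * a = (2 - real n) / 2" by (simp add: a_def)
    then have "F_stein \<sigma> T n y = Q y powr (2 * a)" by (simp only: F_stein_def Q_def w_def)
    then show "sqrt (F_stein \<sigma> T n y) = Q y powr a" 
      by (simp add: powr_half_sqrt[symmetric] powr_powr)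
  qed
  have D1: "((\<lambda>r. Q (y(i := r)) powr p) has_real_derivative p * Q y powr (p - 1) * (2 * y i / w i)) (at (y i))"
    if "i \<in> {1..n}" "Q y > 0" for i y p
    using DERIV_weighted_square_sum_powr[of i n y w p] that by (simp add: Q_def)
  have M1: "malliavin_D \<sigma> n (h_basis \<sigma> T) t (\<lambda>y. Q y powr a) y = (\<Sum>j=1..n. a * Q y powr (a - 1) * (2 * y j / w j) * G j t)"
    if "Q y > 0" for y t
    unfolding malliavin_D_def partial_deriv_def G_def
    by (intro sum.cong refl arg_cong2[where f = "(*)"] DERIV_imp_deriv D1 that)
  \<comment> \<open>The second partial derivatives of \<open>Q powr a\<close> at \<open>x\<close>.\<close>
  define H where "H i j = a * ((a - 1) * Q x powr (a - 2) * (2 * x i / w i)) * (2 * x j / w j)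
      + a * Q x powr (a - 1) * (if i = j then 2 / w j else 0)" for i j
  have M2: "partial_deriv i (malliavin_D \<sigma> n (h_basis \<sigma> T) t (\<lambda>y. Q y powr a)) x = (\<Sum>j=1..n. H i j * G j t)"
    if i: "i \<in> {1..n}" for i t
    unfolding partial_deriv_def
  proof (rule DERIV_imp_deriv)
    have "((\<lambda>r. Q (x(i := r))) \<longlongrightarrow> Q (x(i := x i))) (at (x i))"
      unfolding Q_def weighted_square_sum_update[OF i] using w[OF i] by (intro tendsto_intros) auto
    then have "eventually (\<lambda>r. Q (x(i := r)) > 0) (at (x i))"
      using Qx by (intro order_tendstoD(1)) auto
    \<comment> \<open>The formula \<open>M1\<close> for the inner derivative is available near \<open>x\<close> only, where \<open>Q > 0\<close>.\<close>
    then have ev: "eventually (\<lambda>r. Q (x(i := r)) > 0) (nhds (x i))"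
      using Qx by (simp add: eventually_nhds_conv_at)
    have "((\<lambda>r. \<Sum>j=1..n. a * Q (x(i := r)) powr (a - 1) * (2 * (x(i := r)) j / w j) * G j t) has_real_derivative
        (\<Sum>j=1..n. H i j * G j t)) (at (x i))"
    proof (intro DERIV_sum DERIV_cmult_right)
      fix j assume "j \<in> {1..n}"
      have *: "((\<lambda>r. 2 * (x(i := r)) j / w j) has_real_derivative (if i = j then 2 / w j else 0)) (at (x i))"
        using w[OF \<open>j \<in> {1..n}\<close>] by (cases "i = j") (auto intro!: derivative_eq_intros)
      have "((\<lambda>r. a * Q (x(i := r)) powr (a - 1) * (2 * (x(i := r)) j / w j)) has_real_derivative
         (a * ((a - 1) * Q x powr (a - 1 - 1) * (2 * x i / w i))) * (2 * (x(i := x i)) j / w j) +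
         (if i = j then 2 / w j else 0) * (a * Q (x(i := x i)) powr (a - 1))) (at (x i))"
        by (rule DERIV_mult[OF DERIV_cmult[OF D1[OF i Qx]] *])
      then show "((\<lambda>r. a * Q (x(i := r)) powr (a - 1) * (2 * (x(i := r)) j / w j)) has_real_derivative H i j) (at (x i))"
        by (simp add: H_def mult.commute)
    qed
    then show "((\<lambda>r. malliavin_D \<sigma> n (h_basis \<sigma> T) t (\<lambda>y. Q y powr a) (x(i := r))) has_real_derivative
        (\<Sum>j=1..n. H i j * G j t)) (at (x i))"
      by (rule DERIV_cong_ev[OF refl _ refl, THEN iffD2, rotated]) (use ev in eventually_elim, simp add: M1)
  qed
  have GG: "integrable (lebesgue_on {0..T}) (\<lambda>t. G j t * G i t)" 
    "(LINT t|lebesgue_on {0..T}. G j t * G i t) = (if j = i then w i else 0)" if "i \<in> {1..n}" "j \<in> {1..n}" for i j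
    using Gam_h_basis_orthogonal[OF \<sigma> T, of j i] that by (simp_all add: G_def w_def)
  have "malliavin_laplacian T \<sigma> n (h_basis \<sigma> T) (\<lambda>y. Q y powr a) x =
      (LINT t:{0..T}|lebesgue. (\<Sum>i=1..n. (\<Sum>j=1..n. H i j * G j t) * G i t))"
    unfolding malliavin_laplacian_def malliavin_D_def[of \<sigma> n _ _ "malliavin_D \<sigma> n _ _ _"]
    by (intro set_lebesgue_integral_cong allI impI sum.cong) (simp_all add: M2 G_def)
  also have "\<dots> = (LINT t|lebesgue_on {0..T}. (\<Sum>i=1..n. \<Sum>j=1..n. H i j * (G j t * G i t)))"
    by (simp add: set_lebesgue_integral_def integral_restrict_space sum_distrib_right mult.assoc)
  also have "\<dots> = (\<Sum>i=1..n. LINT t|lebesgue_on {0..T}. (\<Sum>j=1..n. H i j * (G j t * G i t)))"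
    by (intro Bochner_Integration.integral_sum Bochner_Integration.integrable_sum integrable_mult_right GG)
  also have "\<dots> = (\<Sum>i=1..n. \<Sum>j=1..n. LINT t|lebesgue_on {0..T}. H i j * (G j t * G i t))"
    by (intro sum.cong refl Bochner_Integration.integral_sum integrable_mult_right GG)
  also have "\<dots> = (\<Sum>i=1..n. \<Sum>j=1..n. if j = i then H i i * w i else 0)"
    by (intro sum.cong refl) (subst integral_mult_right_zero, subst GG(2), auto)
  also have "\<dots> = (\<Sum>i=1..n. H i i * w i)" by (simp add: sum.delta)
  also have "\<dots> = (\<Sum>i=1..n. 4 * a * (a - 1) * Q x powr (a - 2) * ((x i)\<^sup>2 / w i) + 2 * a * Q x powr (a - 1))"
  proof (intro sum.cong refl)
    fix i assume "i \<in> {1..n}"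
    then have "w i \<noteq> 0" using w by force
    then show "H i i * w i = 4 * a * (a - 1) * Q x powr (a - 2) * ((x i)\<^sup>2 / w i) + 2 * a * Q x powr (a - 1)"
      by (simp add: H_def distrib_right power2_eq_square)
  qed
  also have "\<dots> = 4 * a * (a - 1) * Q x powr (a - 2) * Q x + real n * (2 * a * Q x powr (a - 1))"
    unfolding sum.distrib sum_distrib_left[symmetric] by (simp add: Q_def)
  also have "\<dots> = 4 * a * (a - 1) * (Q x powr a / (Q x)\<^sup>2) * Q x + real n * (2 * a * (Q x powr a / Q x))"
    using Qx by (simp add: powr_diff)
  also have "4 * a * (a - 1) * (Q x powr a / (Q x)\<^sup>2) * Q x + real n * (2 * a * (Q x powr a / Q x)) =
      (Q x powr a) * (- ((real n - 2)\<^sup>2 / 4) / Q x)"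
  proof -
    have "4 * a * (a - 1) * (Q x powr a / (Q x)\<^sup>2) * Q x + real n * (2 * a * (Q x powr a / Q x)) = 
      (Q x powr a) * ((4 * a * (a - 1) + 2 * a * real n) / Q x)"
      using Qx by (simp add: power2_eq_square field_simps)
    also have "4 * a * (a - 1) + 2 * a * real n = - ((real n - 2)\<^sup>2 / 4)"
      by (simp add: a_def power2_eq_square field_simps)
    finally show ?thesis .
  qed
  finally show ?thesis
    using Qx unfolding g fun_cong[OF g] by (simp add: Q_def w_def)
qed

section \<open>The risk of the observation\<close>

text \<open>
  Rounding the time down to a grid gives functions that take countably many values in time and are
  jointly measurable; by continuity of the paths they converge pointwise as the grid is refined.
\<close>

lemma brownian_motion_jointly_measurable:
  assumes bm: "brownian_motion M T \<sigma> W" and T: "T > 0"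
  shows "(\<lambda>(t, \<omega>). indicator {0..T} t * (W t \<omega>)\<^sup>2) \<in> borel_measurable (lborel \<Otimes>\<^sub>M M)"
proof -
  have Wm: "W t \<in> borel_measurable M" if "t \<in> {0..T}" for t
    by (rule brownian_motion_square_integrable[OF bm that])
  \<comment> \<open>The grid points are clamped to \<open>{0..T}\<close>, where the process is measurable and continuous.\<close>
  define p where "p m i = max 0 (min T (of_int i / real (Suc m)))" for m :: nat and i :: int
  define W' where "W' m = (\<lambda>(t, \<omega>). indicator {0..T} t * (W (p m \<lfloor>t * real (Suc m)\<rfloor>) \<omega>)\<^sup>2 :: real)" for m
  have pT: "p m i \<in> {0..T}" for m i using T by (auto simp: p_def)
  have "W' m \<in> borel_measurable (lborel \<Otimes>\<^sub>M M)" for m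
  proof -
    have [measurable]: "W (p m i) \<in> borel_measurable M" for i by (rule Wm[OF pT])
    have "(\<lambda>z. W (p m \<lfloor>fst z * real (Suc m)\<rfloor>) (snd z)) \<in> borel_measurable (lborel \<Otimes>\<^sub>M M)"
      by (rule measurable_compose_countable[where f = "\<lambda>i z. W (p m i) (snd z)" and g = "\<lambda>z. \<lfloor>fst z * real (Suc m)\<rfloor>"]) measurable
    then show ?thesis unfolding W'_def case_prod_unfold by measurable
  qed
  moreover have "(\<lambda>m. W' m z) \<longlonglongrightarrow> (case z of (t, \<omega>) \<Rightarrow> indicator {0..T} t * (W t \<omega>)\<^sup>2)" if "z \<in> space (lborel \<Otimes>\<^sub>M M)" for z
  proof -
    obtain t \<omega> where z: "z = (t, \<omega>)" by (cases z)
    then have \<omega>: "\<omega> \<in> space M" using that by (simp add: space_pair_measure)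
    have "(\<lambda>m. W (p m \<lfloor>t * real (Suc m)\<rfloor>) \<omega>) \<longlonglongrightarrow> W t \<omega>" if t: "t \<in> {0..T}"
    proof -
      have "(\<lambda>m. of_int \<lfloor>t * real (Suc m)\<rfloor> / real (Suc m)) \<longlonglongrightarrow> t"
      proof (rule LIM_zero_cancel, rule Lim_null_comparison[OF always_eventually])
        show "(\<lambda>m. 1 / real (Suc m)) \<longlonglongrightarrow> 0" by (rule LIMSEQ_Suc[OF lim_1_over_n])
        show "\<forall>m. norm (of_int \<lfloor>t * real (Suc m)\<rfloor> / real (Suc m) - t) \<le> 1 / real (Suc m)"
        proof
          fix m
          have "of_int \<lfloor>t * real (Suc m)\<rfloor> / real (Suc m) - t = (of_int \<lfloor>t * real (Suc m)\<rfloor> - t * real (Suc m)) / real (Suc m)"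
            by (simp add: diff_divide_distrib del: of_nat_Suc)
          moreover have "\<bar>of_int \<lfloor>t * real (Suc m)\<rfloor> - t * real (Suc m)\<bar> \<le> 1" by linarith
          ultimately show "norm (of_int \<lfloor>t * real (Suc m)\<rfloor> / real (Suc m) - t) \<le> 1 / real (Suc m)"
            by (simp add: abs_divide divide_right_mono del: of_nat_Suc)
        qed
      qed
      then have "(\<lambda>m. p m \<lfloor>t * real (Suc m)\<rfloor>) \<longlonglongrightarrow> max 0 (min T t)"
        unfolding p_def by (intro tendsto_intros)
      then have *: "(\<lambda>m. p m \<lfloor>t * real (Suc m)\<rfloor>) \<longlonglongrightarrow> t" using t by simp
      have "continuous_on {0..T} (\<lambda>t. W t \<omega>)" using bm \<omega> by (simp add: brownian_motion_def)
      from continuous_on_tendsto_compose[OF this * t] pT show ?thesis by simp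
    qed
    then show ?thesis
      unfolding z W'_def by (cases "t \<in> {0..T}") (auto intro!: tendsto_intros)
  qed
  ultimately show ?thesis by (rule borel_measurable_LIMSEQ_real[rotated])
qed

lemma risk_drifted_brownian_motion:
  assumes bm: "drifted_brownian_motion M T \<sigma> u X" and T: "T > 0"
  shows "risk M T X u = \<sigma>\<^sup>2 * T\<^sup>2 / 2"
proof -
  define W where "W t \<omega> = X t \<omega> - u t" for t \<omega>
  have W: "brownian_motion M T \<sigma> W" using bm by (simp add: drifted_brownian_motion_def W_def[abs_def])
  then interpret prob_space M by (simp add: brownian_motion_def)
  interpret pair_sigma_finite lborel M ..
  define f where "f = (\<lambda>(t, \<omega>). indicator {0..T} t * (W t \<omega>)\<^sup>2)"
  have m: "f \<in> borel_measurable (lborel \<Otimes>\<^sub>M M)" unfolding f_def by (rule brownian_motion_jointly_measurable[OF W T])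
  have E: "(LINT \<omega>|M. f (t, \<omega>)) = \<sigma>\<^sup>2 * (t ^ 1 * indicator {0..T} t)" for t
  proof (cases "t \<in> {0..T}")
    case True
    then have "(LINT \<omega>|M. W t \<omega> * W t \<omega>) = \<sigma>\<^sup>2 * t" using W unfolding brownian_motion_def by simp
    then show ?thesis using True by (simp add: f_def power2_eq_square)
  qed (simp add: f_def)
  have I: "integrable lborel (\<lambda>t. \<sigma>\<^sup>2 * (t ^ 1 * indicator {0..T} t))"
    by (intro integrable_mult_right) (rule borel_integrable_atLeastAtMost, simp)
  have int: "integrable (lborel \<Otimes>\<^sub>M M) f"
  proof (rule Fubini_integrable[OF m])
    have "(LINT \<omega>|M. norm (f (t, \<omega>))) = \<sigma>\<^sup>2 * (t ^ 1 * indicator {0..T} t)" for t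
      unfolding E[symmetric] by (intro Bochner_Integration.integral_cong) (auto simp: f_def)
    then show "integrable lborel (\<lambda>t. LINT \<omega>|M. norm (f (t, \<omega>)))" using I by simp
    show "AE t in lborel. integrable M (\<lambda>\<omega>. f (t, \<omega>))"
    proof (intro AE_I2)
      fix t show "integrable M (\<lambda>\<omega>. f (t, \<omega>))"
        using brownian_motion_square_integrable(2)[OF W, of t] by (cases "t \<in> {0..T}") (simp_all add: f_def)
    qed
  qed
  have "risk M T X u = (LINT \<omega>|M. LINT t|lborel. f (t, \<omega>))"
    unfolding risk_def
  proof (intro Bochner_Integration.integral_cong refl)
    fix \<omega> assume "\<omega> \<in> space M"
    then have c: "continuous_on {0..T} (\<lambda>t. W t \<omega>)" using W by (simp add: brownian_motion_def)
    then have "(\<lambda>t. indicator {0..T} t *\<^sub>R (W t \<omega>)\<^sup>2) \<in> borel_measurable borel"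
      by (intro borel_measurable_continuous_on_indicator continuous_intros) auto
    then show "(LINT t:{0..T}|lebesgue. \<bar>X t \<omega> - u t\<bar>\<^sup>2) = (LINT t|lborel. f (t, \<omega>))"
      by (simp add: set_lebesgue_integral_def f_def W_def[symmetric] integral_completion)
  qed
  also have "\<dots> = (LINT t|lborel. LINT \<omega>|M. f (t, \<omega>))"
    using Fubini_integral[of "\<lambda>t \<omega>. f (t, \<omega>)"] int by simp
  also have "\<dots> = \<sigma>\<^sup>2 * (T\<^sup>2 / 2)"
    unfolding E integral_mult_right_zero using T by (subst integral_power) (auto simp: power2_eq_square)
  finally show ?thesis by simp
qed

section \<open>Inverse moments of quadratic forms by Laplace transform\<close>

text \<open>
  At \<open>q = 0\<close> both sides are infinite. Hence, for random \<open>q\<close>, finiteness of the expectation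
  excludes the value 0.
\<close>

lemma nn_integral_exp_eq_inverse:
  fixes q :: real
  assumes "q \<ge> 0"
  shows "(\<integral>\<^sup>+s. ennreal (exp (- s * q)) * indicator {0..} s \<partial>lborel) = inverse (ennreal q)"
proof (cases "q = 0")
  case True
  have "emeasure lborel {0::real..} = \<infinity>"
  proof (rule ccontr)
    assume "\<not> emeasure lborel {0::real..} = \<infinity>"
    then have lt: "emeasure lborel {0::real..} < \<infinity>" by (simp add: less_top)
    then obtain r where r: "emeasure lborel {0::real..} = ennreal r" "0 \<le> r" by (cases "emeasure lborel {0::real..}") auto
    have "emeasure lborel {0..r + 1} \<le> emeasure lborel {0::real..}" by (intro emeasure_mono) auto
    then have "ennreal (r + 1) \<le> ennreal r" using r by (simp del: ennreal_plus)
    then show False using r by (simp add: ennreal_le_iff del: ennreal_plus)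
  qed
  then show ?thesis using True by simp
next
  case False
  then have q: "q > 0" using assms by simp
  have "(\<integral>\<^sup>+s. ennreal (exp (- s * q)) * indicator {0..} s \<partial>lborel) = ennreal (0 - (- exp (- 0 * q) / q))"
  proof (rule nn_integral_FTC_atLeast)
    show "((\<lambda>s. - exp (- s * q) / q) has_real_derivative exp (- s * q)) (at s)" for s
      using q by (auto intro!: derivative_eq_intros)
    have "((\<lambda>s. exp (- (s * q))) \<longlongrightarrow> 0) at_top"
      using q by (intro filterlim_compose[OF exp_at_bot] filterlim_compose[OF filterlim_uminus_at_bot_at_top]
          filterlim_at_top_mult_tendsto_pos[of _ q] tendsto_const filterlim_ident) (simp_all add: mult.commute)
    then show "((\<lambda>s. - exp (- s * q) / q) \<longlongrightarrow> 0) at_top"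
      using tendsto_divide[OF tendsto_minus[of _ 0] tendsto_const[of q]] q by fastforce
  qed auto
  also have "\<dots> = inverse (ennreal q)" using q by (simp add: inverse_ennreal divide_inverse)
  finally show ?thesis .
qed

text \<open>
  Tonelli's theorem applied to \<open>1 / q = \<integral>exp (- s q) ds\<close>. The finiteness hypothesis also forces
  \<open>q > 0\<close> almost surely, so that the convention \<open>inverse 0 = 0\<close> has no effect.
\<close>

lemma (in prob_space) expectation_inverse_eq_integral:
  assumes [measurable]: "q \<in> borel_measurable M" and q: "\<And>\<omega>. q \<omega> \<ge> (0::real)"
    and fin: "(\<integral>\<^sup>+s. ennreal (LINT \<omega>|M. exp (- s * q \<omega>)) * indicator {0..} s \<partial>lborel) < \<infinity>"
  shows "(LINT \<omega>|M. inverse (q \<omega>)) = (LINT s|lborel. indicator {0..} s * (LINT \<omega>|M. exp (- s * q \<omega>)))"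
proof -
  interpret pair_sigma_finite lborel M ..
  define \<phi> where "\<phi> s = (LINT \<omega>|M. exp (- s * q \<omega>))" for s
  have [measurable]: "\<phi> \<in> borel_measurable borel" unfolding \<phi>_def[abs_def] by measurable
  have \<phi>0: "\<phi> s \<ge> 0" for s by (simp add: \<phi>_def)
  have int: "integrable M (\<lambda>\<omega>. exp (- s * q \<omega>))" if "s \<ge> 0" for s
    using q that by (intro integrable_const_bound[where B = 1]) auto
  have "(\<integral>\<^sup>+\<omega>. inverse (ennreal (q \<omega>)) \<partial>M) = (\<integral>\<^sup>+\<omega>. \<integral>\<^sup>+s. ennreal (exp (- s * q \<omega>)) * indicator {0..} s \<partial>lborel \<partial>M)"
    by (simp only: nn_integral_exp_eq_inverse[OF q])
  also have "\<dots> = (\<integral>\<^sup>+s. \<integral>\<^sup>+\<omega>. ennreal (exp (- s * q \<omega>)) * indicator {0..} s \<partial>M \<partial>lborel)"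
    by (rule Fubini') measurable
  also have "\<dots> = (\<integral>\<^sup>+s. ennreal (\<phi> s) * indicator {0..} s \<partial>lborel)"
  proof (intro nn_integral_cong)
    fix s :: real
    show "(\<integral>\<^sup>+\<omega>. ennreal (exp (- s * q \<omega>)) * indicator {0..} s \<partial>M) = ennreal (\<phi> s) * indicator {0..} s"
      using int[of s] by (cases "s \<ge> 0") (simp_all add: \<phi>_def nn_integral_eq_integral)
  qed
  finally have eq: "(\<integral>\<^sup>+\<omega>. inverse (ennreal (q \<omega>)) \<partial>M) = (\<integral>\<^sup>+s. ennreal (\<phi> s) * indicator {0..} s \<partial>lborel)" .
  have "AE \<omega> in M. inverse (ennreal (q \<omega>)) \<noteq> \<infinity>"
    using eq fin by (intro nn_integral_PInf_AE) (auto simp: \<phi>_def)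
  then have pos: "AE \<omega> in M. q \<omega> > 0"
    by eventually_elim (use q in \<open>auto simp: less_le ennreal_inverse_eq_top_iff\<close>)
  have "(\<integral>\<^sup>+\<omega>. inverse (ennreal (q \<omega>)) \<partial>M) = (\<integral>\<^sup>+\<omega>. ennreal (inverse (q \<omega>)) \<partial>M)"
    using pos by (intro nn_integral_cong_AE) (auto simp: inverse_ennreal elim: eventually_mono)
  moreover have "(LINT \<omega>|M. inverse (q \<omega>)) = enn2real (\<integral>\<^sup>+\<omega>. ennreal (inverse (q \<omega>)) \<partial>M)"
    using q by (intro integral_eq_nn_integral) auto
  moreover have "(LINT s|lborel. indicator {0..} s * \<phi> s) = enn2real (\<integral>\<^sup>+s. ennreal (indicator {0..} s * \<phi> s) \<partial>lborel)"
    using \<phi>0 by (intro integral_eq_nn_integral) auto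
  moreover have "(\<integral>\<^sup>+s. ennreal (indicator {0..} s * \<phi> s) \<partial>lborel) = (\<integral>\<^sup>+s. ennreal (\<phi> s) * indicator {0..} s \<partial>lborel)"
    by (intro nn_integral_cong) (auto simp: indicator_def)
  ultimately show "(LINT \<omega>|M. inverse (q \<omega>)) = (LINT s|lborel. indicator {0..} s * (LINT \<omega>|M. exp (- s * q \<omega>)))"
    unfolding \<phi>_def[symmetric] using eq by simp
qed

lemma (in prob_space) std_normal_iexp:
  assumes d: "distributed M lborel X std_normal_density"
  shows "(CLINT \<omega>|M. iexp (t * X \<omega>)) = exp (- t\<^sup>2 / 2)"
proof -
  have [measurable]: "X \<in> borel_measurable M" using distributed_measurable[OF d] by simp
  have "(CLINT \<omega>|M. iexp (t * X \<omega>)) = (CLINT x|distr M lborel X. iexp (t * x))"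
    by (subst integral_distr) auto
  also have "distr M lborel X = std_normal_distribution"
    using distributed_distr_eq_density[OF d] by simp
  finally show ?thesis
    using fun_cong[OF char_std_normal_distribution, of t] unfolding char_def by simp
qed

text \<open>
  Up to the factor \<open>r\<close>, the integrand is the density of a centered normal law with variance
  \<open>r\<^sup>2 = 1 / (1 + 2 s)\<close>.
\<close>

lemma (in prob_space) std_normal_exp_square:
  assumes d: "distributed M lborel X std_normal_density" and s: "s \<ge> 0"
  shows "(LINT \<omega>|M. exp (- s * (X \<omega>)\<^sup>2)) = (1 + 2 * s) powr (- 1 / 2)"
proof -
  define r where "r = 1 / sqrt (1 + 2 * s)"
  have r: "r > 0" "r\<^sup>2 = 1 / (1 + 2 * s)" using s by (simp_all add: r_def power_divide)
  have "(LINT \<omega>|M. exp (- s * (X \<omega>)\<^sup>2)) = (LINT x|lborel. std_normal_density x * exp (- s * x\<^sup>2))"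
    by (rule distributed_integral[OF d, symmetric]) auto
  also have "\<dots> = (LINT x|lborel. r * normal_density 0 r x)"
  proof (intro Bochner_Integration.integral_cong refl)
    fix x
    have "std_normal_density x * exp (- s * x\<^sup>2) = 1 / sqrt (2 * pi) * exp (- x\<^sup>2 / 2 + - s * x\<^sup>2)"
      by (simp add: normal_density_def exp_add[symmetric])
    also have "- x\<^sup>2 / 2 + - s * x\<^sup>2 = - x\<^sup>2 / (2 * r\<^sup>2)"
      using s by (simp add: r(2) field_simps)
    also have "1 / sqrt (2 * pi) * exp (- x\<^sup>2 / (2 * r\<^sup>2)) = r * normal_density 0 r x"
      using r(1) by (simp add: normal_density_def real_sqrt_mult)
    finally show "std_normal_density x * exp (- s * x\<^sup>2) = r * normal_density 0 r x" .
  qed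
  also have "\<dots> = r" using r by simp
  also have "r = (1 + 2 * s) powr (- 1 / 2)"
    using s powr_minus[of "1 + 2 * s" "1 / 2"] by (simp add: r_def powr_half_sqrt inverse_eq_divide)
  finally show ?thesis .
qed

lemma (in prob_space) indep_std_normal_iexp:
  assumes K: "finite K" and ind: "indep_vars (\<lambda>_. borel) \<eta> K"
    and d: "\<And>k. k \<in> K \<Longrightarrow> distributed M lborel (\<eta> k) std_normal_density"
  shows "(CLINT \<omega>|M. iexp (\<Sum>k\<in>K. b k * \<eta> k \<omega>)) = exp (- (\<Sum>k\<in>K. (b k)\<^sup>2) / 2)"
proof -
  have m: "\<eta> k \<in> borel_measurable M" if "k \<in> K" for k using distributed_measurable[OF d[OF that]] by simp
  have "indep_vars (\<lambda>_. borel) (\<lambda>k \<omega>. iexp (b k * \<eta> k \<omega>)) K"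
    by (rule indep_vars_compose2[OF ind]) measurable
  then have "(CLINT \<omega>|M. \<Prod>k\<in>K. iexp (b k * \<eta> k \<omega>)) = (\<Prod>k\<in>K. CLINT \<omega>|M. iexp (b k * \<eta> k \<omega>))"
    using K m by (intro indep_vars_lebesgue_integral integrable_const_bound[where B = 1]) auto
  also have "\<dots> = (\<Prod>k\<in>K. complex_of_real (exp (- (b k)\<^sup>2 / 2)))"
    by (intro prod.cong refl std_normal_iexp d)
  also have "\<dots> = exp (- (\<Sum>k\<in>K. (b k)\<^sup>2) / 2)"
    using K by (simp add: exp_sum[symmetric] sum_negf sum_divide_distrib flip: of_real_prod)
  also have "(\<lambda>\<omega>. \<Prod>k\<in>K. iexp (b k * \<eta> k \<omega>)) = (\<lambda>\<omega>. iexp (\<Sum>k\<in>K. b k * \<eta> k \<omega>))"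
    using K by (simp add: exp_sum[symmetric] sum_distrib_left)
  finally show ?thesis .
qed

text \<open>
  The Gaussian linearisation of a quadratic exponent: for fixed \<open>y\<close>, the number
  \<open>exp (- s (\<Sum>k. (v\<^sub>k y\<^sub>k)\<^sup>2))\<close> is the characteristic function of \<open>\<eta>\<close> at the point with
  coordinates \<open>sqrt (2 s) v\<^sub>k y\<^sub>k\<close>. Exchanging the expectations over \<open>Y\<close> and \<open>\<eta>\<close> leaves the
  characteristic function of \<open>Y\<close> at a random point.
\<close>

lemma expectation_exp_quadratic_form:
  assumes M: "prob_space M" and Q: "prob_space Q" and K: "finite K"
    and Y: "\<And>k. k \<in> K \<Longrightarrow> Y k \<in> borel_measurable M"
    and char: "\<And>b. (CLINT \<omega>|M. iexp (\<Sum>k\<in>K. b k * Y k \<omega>)) =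
       iexp (\<Sum>k\<in>K. b k * \<mu> k) * complex_of_real (exp (- (\<Sum>k\<in>K. (b k)\<^sup>2) / 2))"
    and ind: "prob_space.indep_vars Q (\<lambda>_. borel) \<eta> K"
    and d: "\<And>k. k \<in> K \<Longrightarrow> distributed Q lborel (\<eta> k) std_normal_density"
    and s: "s \<ge> (0::real)"
  shows "complex_of_real (LINT \<omega>|M. exp (- s * (\<Sum>k\<in>K. (v k)\<^sup>2 * (Y k \<omega>)\<^sup>2))) =
    (CLINT \<omega>|Q. iexp (sqrt (2 * s) * (\<Sum>k\<in>K. v k * \<eta> k \<omega> * \<mu> k)) *
       complex_of_real (exp (- s * (\<Sum>k\<in>K. (v k)\<^sup>2 * (\<eta> k \<omega>)\<^sup>2))))"
proof -
  interpret M: prob_space M by fact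
  interpret Q: prob_space Q by fact
  interpret pair_prob_space M Q ..
  have \<eta>: "\<eta> k \<in> borel_measurable Q" if "k \<in> K" for k using distributed_measurable[OF d[OF that]] by simp
  define c where "c k = sqrt (2 * s) * v k" for k
  have c: "(\<Sum>k\<in>K. (c k * y k)\<^sup>2) / 2 = s * (\<Sum>k\<in>K. (v k)\<^sup>2 * (y k)\<^sup>2)" for y :: "'c \<Rightarrow> real"
    using s by (simp add: c_def power_mult_distrib sum_distrib_left sum_divide_distrib mult.assoc)
  define f where "f \<omega> \<omega>' = iexp (\<Sum>k\<in>K. c k * Y k \<omega> * \<eta> k \<omega>')" for \<omega> \<omega>'
  have "(\<lambda>z. \<Sum>k\<in>K. c k * Y k (fst z) * \<eta> k (snd z)) \<in> borel_measurable (M \<Otimes>\<^sub>M Q)"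
    by (intro borel_measurable_sum borel_measurable_times borel_measurable_const
        measurable_compose[OF measurable_fst Y] measurable_compose[OF measurable_snd \<eta>])
  then have fm: "(\<lambda>z. f (fst z) (snd z)) \<in> borel_measurable (M \<Otimes>\<^sub>M Q)"
    unfolding f_def by measurable
  have fint: "integrable (M \<Otimes>\<^sub>M Q) (case_prod f)"
    using fm by (intro integrable_const_bound[where B = 1]) (auto simp: case_prod_unfold f_def)
  have 1: "(CLINT \<omega>'|Q. f \<omega> \<omega>') = complex_of_real (exp (- s * (\<Sum>k\<in>K. (v k)\<^sup>2 * (Y k \<omega>)\<^sup>2)))" for \<omega>
    using Q.indep_std_normal_iexp[OF K ind d, of "\<lambda>k. c k * Y k \<omega>"] 
    unfolding f_def minus_divide_left[symmetric] c by simp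
  have 2: "(CLINT \<omega>|M. f \<omega> \<omega>') = iexp (sqrt (2 * s) * (\<Sum>k\<in>K. v k * \<eta> k \<omega>' * \<mu> k)) *
       complex_of_real (exp (- s * (\<Sum>k\<in>K. (v k)\<^sup>2 * (\<eta> k \<omega>')\<^sup>2)))" for \<omega>'
  proof -
    have "f \<omega> \<omega>' = iexp (\<Sum>k\<in>K. (c k * \<eta> k \<omega>') * Y k \<omega>)" for \<omega>
      unfolding f_def by (simp only: mult_ac)
    then have "(CLINT \<omega>|M. f \<omega> \<omega>') = iexp (\<Sum>k\<in>K. (c k * \<eta> k \<omega>') * \<mu> k) *
        complex_of_real (exp (- (\<Sum>k\<in>K. (c k * \<eta> k \<omega>')\<^sup>2) / 2))"
      by (simp only: char)
    also have "(\<Sum>k\<in>K. (c k * \<eta> k \<omega>') * \<mu> k) = sqrt (2 * s) * (\<Sum>k\<in>K. v k * \<eta> k \<omega>' * \<mu> k)"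
      by (simp add: c_def sum_distrib_left mult.assoc)
    finally show ?thesis unfolding minus_divide_left[symmetric] c by simp
  qed
  have "complex_of_real (LINT \<omega>|M. exp (- s * (\<Sum>k\<in>K. (v k)\<^sup>2 * (Y k \<omega>)\<^sup>2))) = (CLINT \<omega>|M. CLINT \<omega>'|Q. f \<omega> \<omega>')"
    unfolding 1 by (rule integral_complex_of_real[symmetric])
  also have "\<dots> = (CLINT \<omega>'|Q. CLINT \<omega>|M. f \<omega> \<omega>')"
    by (rule Fubini_integral[OF fint, symmetric])
  finally show ?thesis unfolding 2 .
qed

text \<open>
  Three coordinates already give decay of order \<open>s powr (- 3 / 2)\<close>, which is integrable at
  infinity; two would only give \<open>1 / s\<close>.
\<close>

lemma (in prob_space) std_normal_quadratic_form_bound: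
  assumes K: "finite K" and ind: "indep_vars (\<lambda>_. borel) \<eta> K"
    and d: "\<And>k. k \<in> K \<Longrightarrow> distributed M lborel (\<eta> k) std_normal_density"
    and v: "\<And>k. k \<in> K \<Longrightarrow> (v k)\<^sup>2 \<ge> 1" and J: "J \<subseteq> K" "card J = 3" and s: "s \<ge> 0"
  shows "(LINT \<omega>|M. exp (- s * (\<Sum>k\<in>K. (v k)\<^sup>2 * (\<eta> k \<omega>)\<^sup>2))) \<le> (1 + 2 * s) powr (- 3 / 2)"
proof -
  have m: "\<eta> k \<in> borel_measurable M" if "k \<in> K" for k using distributed_measurable[OF d[OF that]] by simp
  have finJ: "finite J" using J K finite_subset by blast
  have "(LINT \<omega>|M. exp (- s * (\<Sum>k\<in>K. (v k)\<^sup>2 * (\<eta> k \<omega>)\<^sup>2))) \<le> (LINT \<omega>|M. (\<Prod>k\<in>J. exp (- s * (\<eta> k \<omega>)\<^sup>2)))"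
  proof (rule integral_mono)
    show "integrable M (\<lambda>\<omega>. exp (- s * (\<Sum>k\<in>K. (v k)\<^sup>2 * (\<eta> k \<omega>)\<^sup>2)))"
      using s m by (intro integrable_const_bound[where B = 1]) (auto intro!: mult_nonneg_nonneg sum_nonneg)
    show "integrable M (\<lambda>\<omega>. \<Prod>k\<in>J. exp (- s * (\<eta> k \<omega>)\<^sup>2))"
      using s m J by (intro integrable_const_bound[where B = 1] borel_measurable_prod) (auto intro!: prod_le_1 simp: abs_prod subset_iff)
    fix \<omega>
    have "(\<Sum>k\<in>J. (\<eta> k \<omega>)\<^sup>2) \<le> (\<Sum>k\<in>K. (v k)\<^sup>2 * (\<eta> k \<omega>)\<^sup>2)"
    proof (rule order_trans[OF sum_mono2])
      show "(\<Sum>k\<in>K. (\<eta> k \<omega>)\<^sup>2) \<le> (\<Sum>k\<in>K. (v k)\<^sup>2 * (\<eta> k \<omega>)\<^sup>2)"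
        using v mult_right_mono[of 1 "(v _)\<^sup>2" "(\<eta> _ \<omega>)\<^sup>2"] by (intro sum_mono) force
    qed (use K J in auto)
    then have "- s * (\<Sum>k\<in>K. (v k)\<^sup>2 * (\<eta> k \<omega>)\<^sup>2) \<le> - s * (\<Sum>k\<in>J. (\<eta> k \<omega>)\<^sup>2)"
      using s by (simp add: mult_left_mono)
    then show "exp (- s * (\<Sum>k\<in>K. (v k)\<^sup>2 * (\<eta> k \<omega>)\<^sup>2)) \<le> (\<Prod>k\<in>J. exp (- s * (\<eta> k \<omega>)\<^sup>2))"
      using finJ by (simp add: exp_sum[symmetric] sum_distrib_left sum_negf)
  qed
  also have "\<dots> = (\<Prod>k\<in>J. LINT \<omega>|M. exp (- s * (\<eta> k \<omega>)\<^sup>2))"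
  proof (rule indep_vars_lebesgue_integral[OF finJ])
    show "indep_vars (\<lambda>_. borel) (\<lambda>k \<omega>. exp (- s * (\<eta> k \<omega>)\<^sup>2)) J"
      by (rule indep_vars_compose2[OF indep_vars_subset[OF ind J(1)]]) measurable
    show "integrable M (\<lambda>\<omega>. exp (- s * (\<eta> k \<omega>)\<^sup>2))" if "k \<in> J" for k
      using s m J that by (intro integrable_const_bound[where B = 1]) auto
  qed
  also have "\<dots> = (\<Prod>k\<in>J. (1 + 2 * s) powr (- 1 / 2))"
    using J d s by (intro prod.cong refl std_normal_exp_square) auto
  also have "\<dots> = (1 + 2 * s) powr (- 3 / 2)"
    using s J by (simp add: powr_realpow[symmetric] powr_powr powr_power)
  finally show ?thesis .
qed

lemma nn_integral_powr_three_halves: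
  "(\<integral>\<^sup>+s. ennreal ((1 + 2 * s) powr (- 3 / 2)) * indicator {0..} s \<partial>lborel) = 1"
proof -
  have "(\<integral>\<^sup>+s. ennreal ((1 + 2 * s) powr (- 3 / 2)) * indicator {0..} s \<partial>lborel) = ennreal (0 - (- ((1 + 2 * 0) powr (- 1 / 2))))"
  proof (rule nn_integral_FTC_atLeast)
    show "((\<lambda>s. - ((1 + 2 * s) powr (- 1 / 2))) has_real_derivative (1 + 2 * s) powr (- 3 / 2)) (at s)" if "0 \<le> s" for s
      using that by (auto intro!: derivative_eq_intros simp: )
    have "filterlim (\<lambda>s::real. 1 + 2 * s) at_top at_top"
      by (intro filterlim_tendsto_add_at_top[OF tendsto_const] filterlim_tendsto_pos_mult_at_top[OF tendsto_const] filterlim_ident) simp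
    then have "((\<lambda>s::real. (1 + 2 * s) powr (- 1 / 2)) \<longlongrightarrow> 0) at_top"
      by (intro tendsto_neg_powr) simp_all
    then show "((\<lambda>s::real. - ((1 + 2 * s) powr (- 1 / 2))) \<longlongrightarrow> 0) at_top"
      using tendsto_minus by fastforce
  qed auto
  then show ?thesis by simp
qed

section \<open>The limit of the gain\<close>

text \<open>
  The integrands agree everywhere and not only almost everywhere: where the quadratic form vanishes,
  so does \<open>F\<close>, and both quotients are zero by convention. This makes measurability of the
  Laplacian automatic.
\<close>

lemma gain_eq_expectation_inverse:
  assumes \<sigma>: "\<sigma> > 0" and T: "T > 0" and n: "n \<ge> 1" and bm: "drifted_brownian_motion M T \<sigma> u X"
  shows "gain M X Y u \<sigma> T n =
    (real n - 2)\<^sup>2 * (8 / pi\<^sup>2) * (LINT \<omega>|M. inverse (\<Sum>k=1..n. (2 * real k - 1)\<^sup>2 * (Y k \<omega>)\<^sup>2))"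
proof -
  define q where "q x = (\<Sum>k=1..n. (2 * real k - 1)\<^sup>2 * (x k)\<^sup>2)" for x :: "nat \<Rightarrow> real"
  define C where "C = (real n - 2)\<^sup>2 * \<sigma>\<^sup>2 * T\<^sup>2 / pi\<^sup>2"
  have S: "(\<Sum>k=1..n. (x k)\<^sup>2 / (lam \<sigma> T k)\<^sup>2) = pi\<^sup>2 / (4 * \<sigma>\<^sup>2 * T\<^sup>2) * q x" for x
    unfolding q_def sum_distrib_left
  proof (intro sum.cong refl)
    fix k assume "k \<in> {1..n}"
    have "lam \<sigma> T k = 2 * \<sigma> * T / (pi * (2 * real k - 1))"
    proof -
      have "real k - 1 / 2 = (2 * real k - 1) / 2" by simp
      then show ?thesis unfolding lam_def by (simp only: divide_divide_eq_right times_divide_eq_right) simp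
    qed
    then show "(x k)\<^sup>2 / (lam \<sigma> T k)\<^sup>2 = pi\<^sup>2 / (4 * \<sigma>\<^sup>2 * T\<^sup>2) * ((2 * real k - 1)\<^sup>2 * (x k)\<^sup>2)"
      by (simp add: power_divide power_mult_distrib mult_ac)
  qed
  have q0: "q x \<ge> 0" for x unfolding q_def by (intro sum_nonneg) simp
  have "malliavin_laplacian T \<sigma> n (h_basis \<sigma> T) (\<lambda>x. sqrt (F_stein \<sigma> T n x)) x / sqrt (F_stein \<sigma> T n x)
     = - C * inverse (q x)" for x
  proof (cases "q x = 0")
    case True
    then show ?thesis unfolding F_stein_def S by simp
  next
    case False
    then have "q x > 0" using q0[of x] by simp
    then have pos: "(\<Sum>k=1..n. (x k)\<^sup>2 / (lam \<sigma> T k)\<^sup>2) > 0" unfolding S using \<sigma> T by simp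
    show ?thesis
      unfolding malliavin_laplacian_sqrt_F_stein[OF \<sigma> T n pos] S using \<open>q x > 0\<close> \<sigma> T by (simp add: C_def field_simps)
  qed
  then have "gain M X Y u \<sigma> T n = - (4 / (\<sigma>\<^sup>2 * T\<^sup>2 / 2)) * (LINT \<omega>|M. - C * inverse (q (\<lambda>k. Y k \<omega>)))"
    unfolding gain_def risk_drifted_brownian_motion[OF bm T] by simp
  also have "\<dots> = (4 / (\<sigma>\<^sup>2 * T\<^sup>2 / 2)) * C * (LINT \<omega>|M. inverse (q (\<lambda>k. Y k \<omega>)))"
    by simp
  also have "(4 / (\<sigma>\<^sup>2 * T\<^sup>2 / 2)) * C = (real n - 2)\<^sup>2 * (8 / pi\<^sup>2)"
    using \<sigma> T by (simp add: C_def field_simps)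
  finally show ?thesis by (simp add: q_def)
qed

theorem mainTheorem9:
  fixes T :: real and n :: nat and u :: "real \<Rightarrow> real"
    and P :: "real \<Rightarrow> 'a measure"
    and X :: "real \<Rightarrow> real \<Rightarrow> 'a \<Rightarrow> real"
    and Y :: "real \<Rightarrow> nat \<Rightarrow> 'a \<Rightarrow> real"
    and Q :: "'b measure"
    and \<eta> :: "nat \<Rightarrow> 'b \<Rightarrow> real"
  assumes "T > 0" and "n \<ge> 3" and "u \<in> H_space T"
    and "\<And>\<sigma>. \<sigma> > 0 \<Longrightarrow> drifted_brownian_motion (P \<sigma>) T \<sigma> u (X \<sigma>)"
    and "\<And>\<sigma> k. \<sigma> > 0 \<Longrightarrow> k \<in> {1..n} \<Longrightarrow>
           is_X_of (P \<sigma>) T (X \<sigma>) (h_basis \<sigma> T k) (Y \<sigma> k)"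
    and "prob_space Q"
    and "prob_space.indep_vars Q (\<lambda>_. borel) \<eta> {1..n}"
    and "\<And>l. l \<in> {1..n} \<Longrightarrow> distributed Q lborel (\<eta> l) std_normal_density"
  shows "((\<lambda>\<sigma>. gain (P \<sigma>) (X \<sigma>) (Y \<sigma>) u \<sigma> T n) \<longlongrightarrow>
           (real n - 2)\<^sup>2 * (8 / pi\<^sup>2) *
             (LINT \<omega>|Q. inverse (\<Sum>l=1..n. (2 * real l - 1)\<^sup>2 * (\<eta> l \<omega>)\<^sup>2))) at_top"
proof -
  note bm = assms(4) and ind = assms(7) and std = assms(8)
  interpret Q: prob_space Q by fact
  define v where "v k = 2 * real k - 1" for k
  define q where "q x = (\<Sum>k=1..n. (v k)\<^sup>2 * (x k)\<^sup>2)" for x :: "nat \<Rightarrow> real"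
  define \<mu> where "\<mu> \<sigma> k = (LINT \<omega>|P \<sigma>. Y \<sigma> k \<omega>)" for \<sigma> k
  define \<phi> where "\<phi> \<sigma> s = (LINT \<omega>|P \<sigma>. exp (- s * q (\<lambda>k. Y \<sigma> k \<omega>)))" for \<sigma> s
  define \<psi> where "\<psi> s = (LINT \<omega>|Q. exp (- s * q (\<lambda>k. \<eta> k \<omega>)))" for s
  define U where "U = (LINT s|lebesgue_on {0..T}. (deriv u s)\<^sup>2)"
  have v: "(v k)\<^sup>2 \<ge> 1" if "k \<in> {1..n}" for k
    using that one_le_power[of "v k" 2] by (simp add: v_def)
  have q0: "q x \<ge> 0" for x unfolding q_def by (intro sum_nonneg) simp
  have \<eta>m: "\<eta> k \<in> borel_measurable Q" if "k \<in> {1..n}" for k using distributed_measurable[OF std[OF that]] by simp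
  have q\<eta>: "(\<lambda>\<omega>. q (\<lambda>k. \<eta> k \<omega>)) \<in> borel_measurable Q"
    unfolding q_def by (intro borel_measurable_sum borel_measurable_times borel_measurable_const borel_measurable_power \<eta>m)
  have prob: "prob_space (P \<sigma>)" if "\<sigma> > 0" for \<sigma>
    using bm[OF that] by (simp add: drifted_brownian_motion_def brownian_motion_def)
  have Y: "is_stochastic_integral (P \<sigma>) T (X \<sigma>) (deriv (h_basis \<sigma> T k)) (Y \<sigma> k)" if "\<sigma> > 0" "k \<in> {1..n}" for \<sigma> k
    using assms(5)[OF that] by (simp add: is_X_of_def)
  have Ym: "Y \<sigma> k \<in> borel_measurable (P \<sigma>)" if "\<sigma> > 0" "k \<in> {1..n}" for \<sigma> k
    using Y[OF that] by (simp add: is_stochastic_integral_def)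
  have qY: "(\<lambda>\<omega>. q (\<lambda>k. Y \<sigma> k \<omega>)) \<in> borel_measurable (P \<sigma>)" if "\<sigma> > 0" for \<sigma>
    unfolding q_def using that
    by (intro borel_measurable_sum borel_measurable_times borel_measurable_const borel_measurable_power Ym)
  have hm: "deriv (h_basis \<sigma> T k) \<in> borel_measurable (lebesgue_on {0..T})" if "\<sigma> > 0" "k \<in> {1..n}" for \<sigma> k
    using deriv_h_basis_integrable(1)[OF that(1) \<open>T > 0\<close>, of k k] that by simp
  have char: "(CLINT \<omega>|P \<sigma>. iexp (\<Sum>k=1..n. b k * Y \<sigma> k \<omega>)) =
      iexp (\<Sum>k=1..n. b k * \<mu> \<sigma> k) * complex_of_real (exp (- (\<Sum>k=1..n. (b k)\<^sup>2) / 2))" if \<sigma>: "\<sigma> > 0" for \<sigma> b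
    using stochastic_integrals_gaussian(2)[OF bm[OF \<sigma>] assms(3), of "{1..n}" "\<lambda>k. deriv (h_basis \<sigma> T k)" "Y \<sigma>" b] hm[OF \<sigma>] Y[OF \<sigma>]
    by (simp only: deriv_h_basis_combination[OF \<sigma> \<open>T > 0\<close>] finite_atLeastAtMost \<mu>_def)
  have \<mu>_bound: "\<bar>\<mu> \<sigma> k\<bar> \<le> sqrt U * inverse \<sigma>" if \<sigma>: "\<sigma> > 0" and k: "k \<in> {1..n}" for \<sigma> k
  proof -
    have "(LINT s|lebesgue_on {0..T}. (deriv (h_basis \<sigma> T k) s)\<^sup>2) = 1 / \<sigma>\<^sup>2"
      using deriv_h_basis_integrable(3)[OF \<sigma> \<open>T > 0\<close>, of k k] k by (simp add: power2_eq_square)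
    then have "(\<mu> \<sigma> k)\<^sup>2 \<le> U * (1 / \<sigma>\<^sup>2)"
      using stochastic_integrals_gaussian(1)[OF bm[OF \<sigma>] assms(3), of "{1..n}" "\<lambda>k. deriv (h_basis \<sigma> T k)" "Y \<sigma>" k] hm[OF \<sigma>] Y[OF \<sigma>] k
      by (simp add: U_def \<mu>_def)
    then have "\<bar>\<mu> \<sigma> k\<bar> \<le> sqrt (U * (1 / \<sigma>\<^sup>2))" by (intro real_le_rsqrt) simp
    then show ?thesis using \<sigma> by (simp add: real_sqrt_mult real_sqrt_divide inverse_eq_divide)
  qed
  have \<mu>_lim: "((\<lambda>\<sigma>. \<mu> \<sigma> k) \<longlongrightarrow> 0) at_top" if "k \<in> {1..n}" for k
  proof (rule Lim_null_comparison)
    show "eventually (\<lambda>\<sigma>. norm (\<mu> \<sigma> k) \<le> sqrt U * inverse \<sigma>) at_top"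
      using eventually_gt_at_top[of 0] by eventually_elim (simp only: real_norm_def \<mu>_bound[OF _ that])
    show "((\<lambda>\<sigma>. sqrt U * inverse \<sigma>) \<longlongrightarrow> 0) at_top"
      by (intro tendsto_mult_right_zero tendsto_inverse_0_at_top filterlim_ident)
  qed
  \<comment> \<open>The integrand over \<open>Q\<close> whose expectation is \<open>\<phi> \<sigma> s\<close>; its modulus does not depend on \<open>\<sigma>\<close>.\<close>
  define S where "S \<sigma> s \<omega> = iexp (sqrt (2 * s) * (\<Sum>k=1..n. v k * \<eta> k \<omega> * \<mu> \<sigma> k)) *
      complex_of_real (exp (- s * q (\<lambda>k. \<eta> k \<omega>)))" for \<sigma> s \<omega>
  have \<phi>_S: "complex_of_real (\<phi> \<sigma> s) = (CLINT \<omega>|Q. S \<sigma> s \<omega>)" if \<sigma>: "\<sigma> > 0" and s: "s \<ge> 0" for \<sigma> s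
    unfolding \<phi>_def S_def q_def
    by (rule expectation_exp_quadratic_form[OF prob[OF \<sigma>] \<open>prob_space Q\<close> _ Ym[OF \<sigma>] char[OF \<sigma>] ind std s]) auto
  have nS: "norm (S \<sigma> s \<omega>) = exp (- s * q (\<lambda>k. \<eta> k \<omega>))" for \<sigma> s \<omega>
    by (simp add: S_def norm_mult)
  have int\<psi>: "integrable Q (\<lambda>\<omega>. exp (- s * q (\<lambda>k. \<eta> k \<omega>)))" if "s \<ge> 0" for s
    using q0 q\<eta> that by (intro Q.integrable_const_bound[where B = 1]) auto
  have Sm: "S \<sigma> s \<in> borel_measurable Q" for \<sigma> s
  proof -
    have "(\<lambda>\<omega>. \<Sum>k=1..n. v k * \<eta> k \<omega> * \<mu> \<sigma> k) \<in> borel_measurable Q"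
      by (intro borel_measurable_sum borel_measurable_times borel_measurable_const \<eta>m)
    then show ?thesis unfolding S_def using q\<eta> by measurable
  qed
  have \<phi>0: "\<phi> \<sigma> s \<ge> 0" and \<psi>0: "\<psi> s \<ge> 0" for \<sigma> s by (simp_all add: \<phi>_def \<psi>_def)
  have \<phi>_le: "\<phi> \<sigma> s \<le> \<psi> s" if "\<sigma> > 0" "s \<ge> 0" for \<sigma> s
  proof -
    have "\<phi> \<sigma> s = norm (CLINT \<omega>|Q. S \<sigma> s \<omega>)" using \<phi>0 by (simp flip: \<phi>_S[OF that])
    also have "\<dots> \<le> (LINT \<omega>|Q. norm (S \<sigma> s \<omega>))" by (rule integral_norm_bound)
    finally show ?thesis by (simp add: nS \<psi>_def)
  qed
  have \<phi>_lim: "((\<lambda>\<sigma>. \<phi> \<sigma> s) \<longlongrightarrow> \<psi> s) at_top" if s: "s \<ge> 0" for s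
  proof -
    have "((\<lambda>\<sigma>. CLINT \<omega>|Q. S \<sigma> s \<omega>) \<longlongrightarrow> (CLINT \<omega>|Q. complex_of_real (exp (- s * q (\<lambda>k. \<eta> k \<omega>))))) at_top"
    proof (rule integral_dominated_convergence_at_top[where w = "\<lambda>\<omega>. exp (- s * q (\<lambda>k. \<eta> k \<omega>))"])
      show "AE \<omega> in Q. ((\<lambda>\<sigma>. S \<sigma> s \<omega>) \<longlongrightarrow> complex_of_real (exp (- s * q (\<lambda>k. \<eta> k \<omega>)))) at_top"
      proof (intro AE_I2)
        fix \<omega>
        have "((\<lambda>\<sigma>. S \<sigma> s \<omega>) \<longlongrightarrow> iexp (sqrt (2 * s) * (\<Sum>k=1..n. v k * \<eta> k \<omega> * 0)) *
            complex_of_real (exp (- s * q (\<lambda>k. \<eta> k \<omega>)))) at_top"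
          unfolding S_def by (intro tendsto_intros \<mu>_lim)
        then show "((\<lambda>\<sigma>. S \<sigma> s \<omega>) \<longlongrightarrow> complex_of_real (exp (- s * q (\<lambda>k. \<eta> k \<omega>)))) at_top" by simp
      qed
    qed (use Sm q\<eta> int\<psi>[OF s] nS in \<open>auto intro!: always_eventually\<close>)
    then have "((\<lambda>\<sigma>. CLINT \<omega>|Q. S \<sigma> s \<omega>) \<longlongrightarrow> complex_of_real (\<psi> s)) at_top"
      by (simp add: \<psi>_def)
    moreover have "eventually (\<lambda>\<sigma>. (CLINT \<omega>|Q. S \<sigma> s \<omega>) = complex_of_real (\<phi> \<sigma> s)) at_top"
      using eventually_gt_at_top[of 0] by eventually_elim (simp add: \<phi>_S s)
    ultimately have "((\<lambda>\<sigma>. complex_of_real (\<phi> \<sigma> s)) \<longlongrightarrow> complex_of_real (\<psi> s)) at_top"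
      by (rule Lim_transform_eventually)
    then show ?thesis by (simp add: tendsto_of_real_iff)
  qed
  have \<psi>_le: "\<psi> s \<le> (1 + 2 * s) powr (- 3 / 2)" if "s \<ge> 0" for s
    unfolding \<psi>_def q_def
    by (rule Q.std_normal_quadratic_form_bound[OF _ ind std v _ _ that, where J = "{1..3}"]) (use \<open>n \<ge> 3\<close> in auto)
  have \<psi>_fin: "(\<integral>\<^sup>+s. ennreal (\<psi> s) * indicator {0..} s \<partial>lborel) < \<infinity>"
  proof -
    have "(\<integral>\<^sup>+s. ennreal (\<psi> s) * indicator {0..} s \<partial>lborel) \<le> (\<integral>\<^sup>+s. ennreal ((1 + 2 * s) powr (- 3 / 2)) * indicator {0..} s \<partial>lborel)"
    proof (intro nn_integral_mono)
      fix s :: real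
      show "ennreal (\<psi> s) * indicator {0..} s \<le> ennreal ((1 + 2 * s) powr (- 3 / 2)) * indicator {0..} s"
        using ennreal_leI[OF \<psi>_le[of s]] by (cases "s \<ge> 0") simp_all
    qed
    also have "\<dots> < \<infinity>" unfolding nn_integral_powr_three_halves by simp
    finally show ?thesis .
  qed
  have \<phi>_fin: "(\<integral>\<^sup>+s. ennreal (\<phi> \<sigma> s) * indicator {0..} s \<partial>lborel) < \<infinity>" if "\<sigma> > 0" for \<sigma>
    by (rule le_less_trans[OF nn_integral_mono \<psi>_fin]) (auto simp: indicator_def intro!: ennreal_leI \<phi>_le that)
  have \<psi>m: "\<psi> \<in> borel_measurable borel"
    unfolding \<psi>_def using q\<eta> by measurable
  have \<phi>m: "\<phi> \<sigma> \<in> borel_measurable borel" if "\<sigma> > 0" for \<sigma>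
  proof -
    interpret prob_space "P \<sigma>" by (rule prob[OF that])
    show ?thesis unfolding \<phi>_def using qY[OF that] by measurable
  qed
  have int: "integrable lborel (\<lambda>s. indicator {0..} s * \<psi> s)"
  proof (rule integrableI_nonneg)
    have "(\<integral>\<^sup>+s. ennreal (indicator {0..} s * \<psi> s) \<partial>lborel) = (\<integral>\<^sup>+s. ennreal (\<psi> s) * indicator {0..} s \<partial>lborel)"
      by (intro nn_integral_cong) (auto simp: indicator_def)
    then show "(\<integral>\<^sup>+s. ennreal (indicator {0..} s * \<psi> s) \<partial>lborel) < \<infinity>" using \<psi>_fin by simp
  qed (use \<psi>m \<psi>0 in auto)
  \<comment> \<open>For \<open>\<sigma> \<le> 0\<close> nothing is known about \<open>P \<sigma>\<close>, while the dominated convergence theorem asks for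
    measurability at every \<open>\<sigma>\<close>.\<close>
  define \<phi>' where "\<phi>' \<sigma> = (if \<sigma> > 0 then \<phi> \<sigma> else \<psi>)" for \<sigma>
  have lim: "((\<lambda>\<sigma>. LINT s|lborel. indicator {0..} s * \<phi>' \<sigma> s) \<longlongrightarrow> (LINT s|lborel. indicator {0..} s * \<psi> s)) at_top"
  proof (rule integral_dominated_convergence_at_top[OF _ _ int])
    show "(\<lambda>s. indicator {0..} s * \<phi>' \<sigma> s) \<in> borel_measurable lborel" for \<sigma>
      using \<phi>m[of \<sigma>] \<psi>m by (simp add: \<phi>'_def)
    show "eventually (\<lambda>\<sigma>. AE s in lborel. norm (indicator {0..} s * \<phi>' \<sigma> s) \<le> indicator {0..} s * \<psi> s) at_top"
      using \<phi>0 \<psi>0 \<phi>_le by (intro always_eventually allI AE_I2) (auto simp: indicator_def \<phi>'_def)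
    show "AE s in lborel. ((\<lambda>\<sigma>. indicator {0..} s * \<phi>' \<sigma> s) \<longlongrightarrow> indicator {0..} s * \<psi> s) at_top"
    proof (intro AE_I2)
      fix s :: real
      show "((\<lambda>\<sigma>. indicator {0..} s * \<phi>' \<sigma> s) \<longlongrightarrow> indicator {0..} s * \<psi> s) at_top"
      proof (cases "s \<ge> 0")
        case True
        have "eventually (\<lambda>\<sigma>. \<phi> \<sigma> s = \<phi>' \<sigma> s) at_top"
          using eventually_gt_at_top[of 0] by eventually_elim (simp add: \<phi>'_def)
        from Lim_transform_eventually[OF \<phi>_lim[OF True] this] show ?thesis
          by (rule tendsto_mult_left)
      qed simp
    qed
  qed (use \<psi>m in simp)
  have ev: "eventually (\<lambda>\<sigma>. (real n - 2)\<^sup>2 * (8 / pi\<^sup>2) * (LINT s|lborel. indicator {0..} s * \<phi>' \<sigma> s) = gain (P \<sigma>) (X \<sigma>) (Y \<sigma>) u \<sigma> T n) at_top"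
    using eventually_gt_at_top[of 0]
  proof eventually_elim
    case (elim \<sigma>)
    interpret prob_space "P \<sigma>" by (rule prob[OF elim])
    have "(LINT \<omega>|P \<sigma>. inverse (q (\<lambda>k. Y \<sigma> k \<omega>))) = (LINT s|lborel. indicator {0..} s * \<phi> \<sigma> s)"
      unfolding \<phi>_def using \<phi>_fin[OF elim] by (intro expectation_inverse_eq_integral qY elim q0) (simp add: \<phi>_def)
    then show ?case
      using gain_eq_expectation_inverse[OF elim \<open>T > 0\<close> _ bm[OF elim], of n "Y \<sigma>"] \<open>n \<ge> 3\<close> elim by (simp add: \<phi>'_def q_def v_def)
  qed
  have "(LINT \<omega>|Q. inverse (q (\<lambda>k. \<eta> k \<omega>))) = (LINT s|lborel. indicator {0..} s * \<psi> s)"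
    unfolding \<psi>_def using \<psi>_fin by (intro Q.expectation_inverse_eq_integral q\<eta> q0) (simp add: \<psi>_def)
  then show ?thesis
    using Lim_transform_eventually[OF tendsto_mult_left[OF lim] ev] by (simp add: q_def v_def)
qed

end
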